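(* For every integer $n>10^8$, $$0.01\log_2 n < k_{\min}(n)\le \log_2 n+1.$$ Moreover, if $k\le 0.01\log_2 n$, then Builder has a strategy to win the Painter-Builder $k$-colouring game on $[n]$ while keeping the game graph bipartite throughout the whole game.
   Context: The Painter-Builder $k$-colouring game on $[n]=\{1,\dots,n\}$ ($n\ge 2$, $k$ positive integers) is a two-player perfect-information game between Painter and Builder, who alternate turns with Painter moving first. The game graph has vertex set $[n]$ and initially no edges, and all vertices are initially uncoloured. In each round, Painter colours one previously uncoloured vertex with one of $k$ colours, and then Builder adds to the game graph an edge between two previously non-adjacent vertices. Both players must maintain that the game graph is properly coloured (no edge joins two coloured vertices of the same colour). The game ends when either all $n$ vertices are coloured (Painter wins) or Painter has no legal move, i.e. some uncoloured vertex has neighbours of all $k$ colours (Builder wins). $k_{\min}(n)$ denotes the minimum $k$ such that Painter has a winning strategy in the $k$-colouring game on $[n]$. *)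

theory Defs
  imports Complex_Main
begin

datatype player = Painter | Builder

text \<open>Vertices and colours are natural numbers; an edge is a two-element set of vertices, and
  uncoloured vertices are mapped to \<^const>\<open>None\<close>.\<close>

record position =
  colouring :: "nat \<Rightarrow> nat option"
  edges :: "nat set set"

definition start :: position where
  "start = \<lparr>colouring = Map.empty, edges = {}\<rparr>"

definition properly_coloured :: "position \<Rightarrow> bool" where
  "properly_coloured p \<longleftrightarrow>
     (\<forall>u v i j. {u, v} \<in> edges p \<and> colouring p u = Some i \<and> colouring p v = Some j \<longrightarrow> i \<noteq> j)"

definition painter_move :: "nat \<Rightarrow> nat \<Rightarrow> position \<Rightarrow> position \<Rightarrow> bool" where
  "painter_move n k p p' \<longleftrightarrow>
     (\<exists>v\<in>{1..n}. \<exists>i\<in>{1..k}. colouring p v = None \<and>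
        p' = p\<lparr>colouring := (colouring p)(v \<mapsto> i)\<rparr> \<and> properly_coloured p')"

definition builder_move :: "nat \<Rightarrow> position \<Rightarrow> position \<Rightarrow> bool" where
  "builder_move n p p' \<longleftrightarrow>
     (\<exists>u\<in>{1..n}. \<exists>v\<in>{1..n}. u \<noteq> v \<and> {u, v} \<notin> edges p \<and>
        p' = p\<lparr>edges := insert {u, v} (edges p)\<rparr> \<and> properly_coloured p')"

fun legal_move :: "nat \<Rightarrow> nat \<Rightarrow> player \<Rightarrow> position \<Rightarrow> position \<Rightarrow> bool" where
  "legal_move n k Painter p p' = painter_move n k p p'"
| "legal_move n k Builder p p' = builder_move n p p'"

text \<open>Builder wins as soon as some uncoloured vertex sees all colours, even if Painter could still
  colour other vertices: Painter can then no longer colour every vertex.\<close>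

fun won :: "nat \<Rightarrow> nat \<Rightarrow> player \<Rightarrow> position \<Rightarrow> bool" where
  "won n k Painter p \<longleftrightarrow> (\<forall>v\<in>{1..n}. colouring p v \<noteq> None)"
| "won n k Builder p \<longleftrightarrow>
     (\<exists>v\<in>{1..n}. colouring p v = None \<and>
        (\<forall>i\<in>{1..k}. \<exists>u. {u, v} \<in> edges p \<and> colouring p u = Some i))"

definition game_over :: "nat \<Rightarrow> nat \<Rightarrow> position \<Rightarrow> bool" where
  "game_over n k p \<longleftrightarrow> (\<exists>w. won n k w p)"

text \<open>A play is recorded as the nonempty list of positions reached so far, beginning with the start
  position. Painter moves first, hence is to move exactly when this list has odd length.\<close>

definition to_move :: "position list \<Rightarrow> player" where
  "to_move ps = (if odd (length ps) then Painter else Builder)"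

inductive play :: "nat \<Rightarrow> nat \<Rightarrow> position list \<Rightarrow> bool" for n k :: nat where
  play_start: "play n k [start]"
| play_step: "play n k ps \<Longrightarrow> \<not> game_over n k (last ps) \<Longrightarrow>
    legal_move n k (to_move ps) (last ps) p \<Longrightarrow> play n k (ps @ [p])"

definition complete_play :: "nat \<Rightarrow> nat \<Rightarrow> position list \<Rightarrow> bool" where
  "complete_play n k ps \<longleftrightarrow> play n k ps \<and> (\<nexists>p. play n k (ps @ [p]))"

text \<open>A strategy sees the whole history of the play and answers with the position resulting from
  the chosen move.\<close>

type_synonym strategy = "position list \<Rightarrow> position"

definition follows :: "player \<Rightarrow> strategy \<Rightarrow> position list \<Rightarrow> bool" where
  "follows w s ps \<longleftrightarrow>
     (\<forall>j. 0 < j \<and> j < length ps \<and> to_move (take j ps) = w \<longrightarrow> ps ! j = s (take j ps))"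

definition legal_strategy :: "nat \<Rightarrow> nat \<Rightarrow> player \<Rightarrow> strategy \<Rightarrow> bool" where
  "legal_strategy n k w s \<longleftrightarrow>
     (\<forall>ps. play n k ps \<and> follows w s ps \<and> \<not> game_over n k (last ps) \<and> to_move ps = w \<longrightarrow>
        legal_move n k w (last ps) (s ps))"

definition winning_strategy :: "nat \<Rightarrow> nat \<Rightarrow> player \<Rightarrow> strategy \<Rightarrow> bool" where
  "winning_strategy n k w s \<longleftrightarrow> legal_strategy n k w s \<and>
     (\<forall>ps. complete_play n k ps \<and> follows w s ps \<longrightarrow> won n k w (last ps))"

definition k_min :: "nat \<Rightarrow> nat" where
  "k_min n = (LEAST k. 0 < k \<and> (\<exists>s. winning_strategy n k Painter s))"

definition bipartite :: "nat set \<Rightarrow> nat set set \<Rightarrow> bool" where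
  "bipartite V E \<longleftrightarrow>
     (\<exists>A B. A \<union> B = V \<and> A \<inter> B = {} \<and> (\<forall>e\<in>E. \<exists>a\<in>A. \<exists>b\<in>B. e = {a, b}))"

definition keeps_bipartite :: "nat \<Rightarrow> nat \<Rightarrow> player \<Rightarrow> strategy \<Rightarrow> bool" where
  "keeps_bipartite n k w s \<longleftrightarrow>
     (\<forall>ps. play n k ps \<and> follows w s ps \<longrightarrow> (\<forall>p\<in>set ps. bipartite {1..n} (edges p)))"

end

theory Submission
  imports Defs
begin

text \<open>Painter's reply keeps the uncoloured vertices independent, so that the set of colours seen by an
  uncoloured vertex grows only when Builder joins two uncoloured vertices \<open>u\<close> and \<open>w\<close> that see the same
  set \<open>F\<close>; one of them is coloured at once, so the sum of \<open>2 ^ |F|\<close> never grows. Painter moreover keeps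
  the sets of size \<open>k - 2\<close> distinct: for \<open>|F| = k - 3\<close> one of the three free colours leads to an unused
  set, since otherwise the sum would be at least \<open>2 ^ k\<close>. No vertex ever sees \<open>k - 1\<close> colours after
  Painter's move.

  Builder turns many vertices in distinct components that see \<open>j\<close> colours each into a constant
  fraction of vertices that see \<open>j + 1\<close> colours. He first pairs vertices that see the same colours. If
  Painter colours a vertex of a pair, then its partner sees a further colour; if he colours an unpaired
  vertex, then the \<open>j + 1\<close> colours in its component contain one that a given pair does not see. Once
  there are many intact pairs, Builder lets them see such colours, and Painter needs two moves to
  destroy a pair. When Painter plays elsewhere, Builder uses up an irrelevant component, which exists
  because the graph is a forest with fewer edges than coloured vertices. Only distinct components are
  ever joined, so the graph stays bipartite.\<close>

section \<open>Plays and strategies\<close>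

text \<open>A set \<open>{u, u}\<close> collapses to a singleton, so forbidding singletons excludes
  loops. Finiteness makes \<open>card (edges p)\<close> meaningful.\<close>

definition sound :: "nat \<Rightarrow> nat \<Rightarrow> position \<Rightarrow> bool" where
  "sound n k p \<longleftrightarrow> properly_coloured p \<and> finite (edges p) \<and> (\<forall>v. {v} \<notin> edges p) \<and>
     (\<forall>v i. colouring p v = Some i \<longrightarrow> v \<in> {1..n} \<and> i \<in> {1..k})"

lemma sound_dom: "sound n k p \<Longrightarrow> dom (colouring p) \<subseteq> {1..n}"
  by (auto simp: sound_def)

lemma sound_start: "sound n k start"
  by (auto simp: sound_def start_def properly_coloured_def)

lemma sound_move:
  assumes "sound n k p" "legal_move n k w p p'"
  shows "sound n k p'"
proof (cases w)
  case Painter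
  with assms show ?thesis
    by (auto simp: sound_def painter_move_def split: if_splits)
next
  case Builder
  with assms show ?thesis
    by (auto simp: sound_def builder_move_def doubleton_eq_iff)
qed

lemma painter_move_free:
  assumes "sound n k p" "v \<in> {1..n}" "colouring p v = None" "i \<in> {1..k}"
    and "\<And>u. {u, v} \<in> edges p \<Longrightarrow> colouring p u \<noteq> Some i"
  shows "painter_move n k p (p\<lparr>colouring := (colouring p)(v \<mapsto> i)\<rparr>)"
proof -
  have "properly_coloured (p\<lparr>colouring := (colouring p)(v \<mapsto> i)\<rparr>)"
    unfolding properly_coloured_def
  proof (intro allI impI, elim conjE)
    fix a b x y
    assume e: "{a, b} \<in> edges (p\<lparr>colouring := (colouring p)(v \<mapsto> i)\<rparr>)"
      and x: "colouring (p\<lparr>colouring := (colouring p)(v \<mapsto> i)\<rparr>) a = Some x"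
      and y: "colouring (p\<lparr>colouring := (colouring p)(v \<mapsto> i)\<rparr>) b = Some y"
    have e': "{a, b} \<in> edges p" "{b, a} \<in> edges p"
      using e by (simp_all add: insert_commute)
    with assms(1) have "a \<noteq> b"
      by (auto simp: sound_def)
    with e' x y assms(1,5) show "x \<noteq> y"
      by (auto simp: sound_def properly_coloured_def split: if_splits)
  qed
  with assms show ?thesis
    unfolding painter_move_def by blast
qed

lemma play_nonempty: "play n k ps \<Longrightarrow> ps \<noteq> []"
  by (induction rule: play.induct) auto

text \<open>Painter moves at odd history lengths and Builder at even ones, so the length fixes how
  many vertices are coloured and how many edges exist.\<close>

lemma play_sound:
  assumes "play n k ps"
  shows "sound n k (last ps) \<and> card (edges (last ps)) = (length ps - 1) div 2 \<and>
    card (dom (colouring (last ps))) = length ps div 2"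
  using assms
proof (induction rule: play.induct)
  case play_start
  then show ?case
    by (simp add: sound_start) (simp add: start_def)
next
  case (play_step ps p)
  have s: "sound n k p"
    using play_step.IH play_step.hyps(3) by (blast intro: sound_move)
  have fin: "finite (dom (colouring (last ps)))"
    using play_step.IH finite_subset[OF sound_dom, of n k "last ps"] by simp
  have ne: "length ps > 0"
    using play_step.hyps(1) play_nonempty by auto
  show ?case
  proof (cases "odd (length ps)")
    case True
    then obtain v i where v: "colouring (last ps) v = None"
      "p = (last ps)\<lparr>colouring := (colouring (last ps))(v \<mapsto> i)\<rparr>"
      using play_step.hyps(3) by (simp add: to_move_def painter_move_def) blast
    then have "card (dom (colouring p)) = Suc (card (dom (colouring (last ps))))"
      using fin by (simp add: domIff)
    moreover have "edges p = edges (last ps)"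
      using v by simp
    moreover have "Suc (length ps div 2) = Suc (length ps) div 2" "(length ps - 1) div 2 = length ps div 2"
      using True by presburger+
    ultimately show ?thesis
      using s play_step.IH by simp
  next
    case False
    then obtain u v where v: "{u, v} \<notin> edges (last ps)"
      "p = (last ps)\<lparr>edges := insert {u, v} (edges (last ps))\<rparr>"
      using play_step.hyps(3) by (simp add: to_move_def builder_move_def) blast
    then have "card (edges p) = Suc (card (edges (last ps)))"
      using play_step.IH by (simp add: sound_def)
    moreover have "colouring p = colouring (last ps)"
      using v by simp
    moreover have "Suc ((length ps - 1) div 2) = length ps div 2" "Suc (length ps) div 2 = length ps div 2"
      using False ne by presburger+
    ultimately show ?thesis
      using s play_step.IH by simp
  qed
qed

text \<open>Builder is never stuck: when it is his turn there are fewer than \<open>n - 1\<close> edges, so no uncoloured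
  vertex is joined to all others.\<close>

lemma legal_move_exists:
  assumes play: "play n k ps" and "\<not> game_over n k (last ps)"
  shows "\<exists>p. legal_move n k (to_move ps) (last ps) p"
proof -
  define p where "p = last ps"
  have s: "sound n k p" and e: "card (edges p) = (length ps - 1) div 2"
    and d: "card (dom (colouring p)) = length ps div 2"
    using play_sound[OF play] by (auto simp: p_def)
  have nw: "\<not> won n k Painter p" "\<not> won n k Builder p"
    using assms(2) unfolding game_over_def p_def by blast+
  then obtain v where v: "v \<in> {1..n}" "colouring p v = None"
    by auto
  show ?thesis
  proof (cases "odd (length ps)")
    case True
    obtain i where i: "i \<in> {1..k}" "\<And>u. {u, v} \<in> edges p \<Longrightarrow> colouring p u \<noteq> Some i"
      using nw(2) v unfolding won.simps by blast
    from painter_move_free[OF s v i] True show ?thesis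
      unfolding p_def to_move_def by auto
  next
    case False
    have "\<exists>u\<in>{1..n} - {v}. {u, v} \<notin> edges p"
    proof (rule ccontr)
      assume "\<not> ?thesis"
      then have "(\<lambda>u. {u, v}) ` ({1..n} - {v}) \<subseteq> edges p"
        by auto
      moreover have "inj_on (\<lambda>u. {u, v}) ({1..n} - {v})"
        by (auto simp: inj_on_def doubleton_eq_iff)
      ultimately have "card ({1..n} - {v}) \<le> card (edges p)"
        using s by (metis card_image card_mono sound_def)
      then have 1: "n - 1 \<le> (length ps - 1) div 2"
        using v e by simp
      have "dom (colouring p) \<subset> {1..n}"
        using v sound_dom[OF s] domIff[of v "colouring p"] by blast
      from psubset_card_mono[OF _ this] have "length ps div 2 < n"
        using d by simp
      moreover have "0 < length ps"
        using play_nonempty[OF play] by simp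
      ultimately show False
        using 1 False by presburger
    qed
    then obtain u where u: "u \<in> {1..n}" "u \<noteq> v" "{u, v} \<notin> edges p"
      by blast
    have "properly_coloured (p\<lparr>edges := insert {u, v} (edges p)\<rparr>)"
      using s v u by (auto simp: sound_def properly_coloured_def doubleton_eq_iff)
    then have "builder_move n p (p\<lparr>edges := insert {u, v} (edges p)\<rparr>)"
      using u v unfolding builder_move_def by blast
    with False show ?thesis
      unfolding p_def to_move_def by auto
  qed
qed

section \<open>From positional invariants to winning strategies\<close>

fun opponent :: "player \<Rightarrow> player" where
  "opponent Painter = Builder"
| "opponent Builder = Painter"

lemma opponent_opponent [simp]: "opponent (opponent w) = w"
  by (cases w) auto

lemma to_move_snoc: "to_move (ps @ [p]) = opponent (to_move ps)"
  by (auto simp: to_move_def)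

lemma not_to_move: "to_move ps \<noteq> w \<Longrightarrow> to_move ps = opponent w"
  by (cases w; cases "to_move ps") auto

lemma follows_snoc:
  "ps \<noteq> [] \<Longrightarrow> follows w s (ps @ [p]) \<longleftrightarrow> follows w s ps \<and> (to_move ps = w \<longrightarrow> p = s ps)"
  by (auto simp: follows_def nth_append less_Suc_eq)

lemma play_snocD:
  assumes "play n k (ps @ [p])" "ps \<noteq> []"
  shows "play n k ps" "\<not> game_over n k (last ps)" "legal_move n k (to_move ps) (last ps) p"
  using assms by (auto elim: play.cases)

text \<open>Here the first argument of \<open>K\<close> is the player to move. A complete play ends
  in a decided position, as otherwise a legal move exists, and \<open>safe\<close> rules out the
  opponent. The second conclusion exports \<open>K\<close> to every position of a play, which later
  yields bipartiteness.\<close>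

lemma winning_strategy_from_invariant:
  assumes start: "K Painter start"
    and own: "\<And>p. K w p \<Longrightarrow> sound n k p \<Longrightarrow> \<not> game_over n k p \<Longrightarrow>
      \<exists>p'. legal_move n k w p p' \<and> K (opponent w) p'"
    and other: "\<And>p p'. K (opponent w) p \<Longrightarrow> sound n k p \<Longrightarrow> legal_move n k (opponent w) p p' \<Longrightarrow> K w p'"
    and safe: "\<And>v p. K v p \<Longrightarrow> sound n k p \<Longrightarrow> \<not> won n k (opponent w) p"
  obtains s where "winning_strategy n k w s"
    "\<And>ps p. play n k ps \<Longrightarrow> follows w s ps \<Longrightarrow> p \<in> set ps \<Longrightarrow> \<exists>v. K v p"
proof -
  \<comment> \<open>Choice turns \<open>own\<close> into an answer that depends on the last position
    only.\<close>
  define s where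
    "s ps = (SOME p'. legal_move n k w (last ps) p' \<and> K (opponent w) p')" for ps
  have s: "legal_move n k w (last ps) (s ps) \<and> K (opponent w) (s ps)"
    if "play n k ps" "\<not> game_over n k (last ps)" "K w (last ps)" for ps
    unfolding s_def by (rule someI_ex) (use own play_sound that in blast)
  have inv: "follows w s ps \<Longrightarrow> K (to_move ps) (last ps) \<and> (\<forall>p\<in>set ps. \<exists>v. K v p)"
    if "play n k ps" for ps
    using that
  proof (induction rule: play.induct)
    case play_start
    then show ?case
      using start by (auto simp: to_move_def)
  next
    case (play_step ps p)
    have ne: "ps \<noteq> []"
      using play_nonempty play_step.hyps(1) by blast
    with play_step.prems have f: "follows w s ps" "to_move ps = w \<longrightarrow> p = s ps"
      by (simp_all add: follows_snoc)
    with play_step.IH have K: "K (to_move ps) (last ps)" "\<forall>p\<in>set ps. \<exists>v. K v p"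
      by auto
    have "K (opponent (to_move ps)) p"
    proof (cases "to_move ps = w")
      case True
      with s[OF play_step.hyps(1,2)] K f show ?thesis
        by simp
    next
      case False
      then have "to_move ps = opponent w"
        by (rule not_to_move)
      with other play_sound[OF play_step.hyps(1)] play_step.hyps(3) K show ?thesis
        by auto
    qed
    with K show ?case
      by (auto simp: to_move_snoc)
  qed
  have "legal_strategy n k w s"
    unfolding legal_strategy_def using s inv by blast
  moreover have "won n k w (last ps)" if "complete_play n k ps" "follows w s ps" for ps
  proof -
    have p: "play n k ps" "\<nexists>p. play n k (ps @ [p])"
      using that(1) by (auto simp: complete_play_def)
    then have "game_over n k (last ps)"
      using legal_move_exists play_step by blast
    then obtain v where v: "won n k v (last ps)"
      by (auto simp: game_over_def)
    have "\<not> won n k (opponent w) (last ps)"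
      using safe inv[OF p(1) that(2)] play_sound[OF p(1)] by blast
    with v show ?thesis
      by (cases v; cases w) auto
  qed
  ultimately have "winning_strategy n k w s"
    unfolding winning_strategy_def by blast
  then show thesis
    using that inv by blast
qed

text \<open>Playing the strategies against each other gives a complete play won by both, yet
  Painter's win leaves no uncoloured vertex.\<close>

lemma not_both_winning:
  assumes P: "winning_strategy n k Painter s" and B: "winning_strategy n k Builder t"
  shows False
proof -
  define Q where "Q ps \<longleftrightarrow> play n k ps \<and> follows Painter s ps \<and> follows Builder t ps" for ps
  have "Q [start]"
    by (auto simp: Q_def follows_def play_start)
  \<comment> \<open>Half of the history length counts coloured vertices, so a longest common play
    exists.\<close>
  moreover have bound: "length ps < 2 * n + 2" if "Q ps" for ps
  proof -
    have "play n k ps"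
      using that by (simp add: Q_def)
    note f = play_sound[OF this]
    then have "card (dom (colouring (last ps))) \<le> card {1..n}"
      by (intro card_mono sound_dom) auto
    with f show ?thesis
      by simp
  qed
  ultimately obtain ps where ps: "Q ps" "\<And>qs. Q qs \<Longrightarrow> length qs \<le> length ps"
    using ex_has_greatest_nat[of Q "[start]" length "2 * n + 2"] by metis
  have play: "play n k ps" and f: "follows Painter s ps" "follows Builder t ps"
    using ps(1) by (auto simp: Q_def)
  have "complete_play n k ps"
    unfolding complete_play_def
  proof (intro conjI notI play)
    assume "\<exists>p. play n k (ps @ [p])"
    then have go: "\<not> game_over n k (last ps)"
      using play_nonempty[OF play] play_snocD by blast
    define p where "p = (if to_move ps = Painter then s ps else t ps)"
    have "legal_move n k (to_move ps) (last ps) p"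
      using P B go play f unfolding winning_strategy_def legal_strategy_def p_def
      by (cases "to_move ps") auto
    then have "Q (ps @ [p])"
      using play go f play_nonempty[OF play]
      by (auto simp: Q_def follows_snoc p_def intro: play_step)
    with ps(2) show False
      by fastforce
  qed
  with P B f have "won n k Painter (last ps)" "won n k Builder (last ps)"
    by (auto simp: winning_strategy_def simp del: won.simps)
  then show False
    by auto
qed

section \<open>Painter\<close>

definition forbidden :: "position \<Rightarrow> nat \<Rightarrow> nat set" where
  "forbidden p v = {i. \<exists>u. {u, v} \<in> edges p \<and> colouring p u = Some i}"

definition uncoloured :: "nat \<Rightarrow> position \<Rightarrow> nat set" where
  "uncoloured n p = {v \<in> {1..n}. colouring p v = None}"

text \<open>Painter's invariant, to hold after each move of Painter. The weight bound is
  \<open>n\<close> because at the start each vertex sees the empty set and contributes 1.\<close>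

definition tame :: "nat \<Rightarrow> nat \<Rightarrow> position \<Rightarrow> bool" where
  "tame n k p \<longleftrightarrow>
     (\<forall>u\<in>uncoloured n p. \<forall>v\<in>uncoloured n p. {u, v} \<notin> edges p) \<and>
     (\<Sum>v\<in>uncoloured n p. 2 ^ card (forbidden p v)) \<le> n \<and>
     (\<forall>v\<in>uncoloured n p. card (forbidden p v) + 2 \<le> k) \<and>
     (\<forall>u\<in>uncoloured n p. \<forall>v\<in>uncoloured n p.
        forbidden p u = forbidden p v \<and> card (forbidden p v) + 2 = k \<longrightarrow> u = v)"

lemma finite_uncoloured [simp]: "finite (uncoloured n p)"
  by (simp add: uncoloured_def)

lemma forbidden_subset: "sound n k p \<Longrightarrow> forbidden p v \<subseteq> {1..k}"
  by (auto simp: forbidden_def sound_def)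

lemma finite_forbidden: "sound n k p \<Longrightarrow> finite (forbidden p v)"
  by (rule finite_subset[OF forbidden_subset]) auto

lemma won_Builder_forbidden:
  "won n k Builder p \<longleftrightarrow> (\<exists>v\<in>uncoloured n p. {1..k} \<subseteq> forbidden p v)"
  by (auto simp: uncoloured_def forbidden_def)

lemma tame_not_won:
  assumes "tame n k p" "sound n k p"
  shows "\<not> won n k Builder p"
proof
  assume "won n k Builder p"
  then obtain v where v: "v \<in> uncoloured n p" "{1..k} \<subseteq> forbidden p v"
    unfolding won_Builder_forbidden by blast
  then have "k \<le> card (forbidden p v)"
    using card_mono[OF finite_forbidden[OF assms(2)] v(2)] by simp
  moreover have "card (forbidden p v) + 2 \<le> k"
    using assms(1) v(1) by (simp add: tame_def)
  ultimately show False by simp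
qed

text \<open>A vertex that sees all colours cannot be the one coloured, and its coloured neighbours
  stay coloured. A Builder win would thus persist through a reply of Painter.\<close>

lemma painter_move_won_Builder:
  assumes "painter_move n k p p'" "won n k Builder p"
  shows "won n k Builder p'"
proof -
  from assms(1) obtain v i where i: "i \<in> {1..k}"
    and p': "p' = p\<lparr>colouring := (colouring p)(v \<mapsto> i)\<rparr>" "colouring p v = None" "properly_coloured p'"
    unfolding painter_move_def by blast
  from assms(2) obtain x where x: "x \<in> {1..n}" "colouring p x = None"
    "\<forall>i\<in>{1..k}. \<exists>u. {u, x} \<in> edges p \<and> colouring p u = Some i"
    unfolding won.simps by blast
  from x(3) i obtain u where u: "{u, x} \<in> edges p" "colouring p u = Some i"
    by blast
  have "x \<noteq> v"
  proof
    assume "x = v"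
    then have "{u, v} \<in> edges p'" "colouring p' u = Some i" "colouring p' v = Some i"
      using u p' by auto
    with p'(3) show False
      unfolding properly_coloured_def by blast
  qed
  moreover have "\<exists>u. {u, x} \<in> edges p' \<and> colouring p' u = Some i" if i: "i \<in> {1..k}" for i
  proof -
    from x(3) i obtain u where u: "{u, x} \<in> edges p" "colouring p u = Some i"
      by blast
    with p'(2) have "u \<noteq> v" by auto
    with u p'(1) show ?thesis by auto
  qed
  moreover have "colouring p' x = None"
    using calculation(1) x p'(1) by simp
  ultimately show ?thesis
    using x(1) unfolding won.simps by blast
qed

text \<open>With \<open>k = 2\<close> the empty sets would already have the size
  \<open>k - 2\<close> at which sets must be distinct.\<close>

lemma tame_start: "3 \<le> k \<Longrightarrow> tame n k start"
proof -
  have "uncoloured n start = {1..n}"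
    by (auto simp: start_def uncoloured_def)
  then show "3 \<le> k \<Longrightarrow> tame n k start"
    by (simp add: tame_def start_def forbidden_def)
qed

section \<open>Effect of colouring a vertex on Painter's invariant\<close>

lemma forbidden_colour:
  assumes "colouring p v = None"
  shows "forbidden (p\<lparr>colouring := (colouring p)(v \<mapsto> i)\<rparr>) w =
    (if {v, w} \<in> edges p then insert i (forbidden p w) else forbidden p w)"
proof -
  have "u \<noteq> v" if "colouring p u = Some x" for u x
    using assms that by auto
  then show ?thesis
    by (auto simp: forbidden_def)
qed

lemma uncoloured_colour:
  "uncoloured n (p\<lparr>colouring := (colouring p)(v \<mapsto> i)\<rparr>) = uncoloured n p - {v}"
  by (auto simp: uncoloured_def)

text \<open>Covers replies that show no remaining vertex a new colour: the weight only loses the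
  term of \<open>v\<close>. As \<open>q\<close> precedes Builder's move and \<open>p\<close> follows
  the reply, \<open>E\<close> constrains only edges between uncoloured vertices.\<close>

lemma tame_remove:
  assumes tame: "tame n k q" and v: "v \<in> uncoloured n q"
    and U: "uncoloured n p = uncoloured n q - {v}"
    and E: "\<And>x y. x \<in> uncoloured n p \<Longrightarrow> y \<in> uncoloured n p \<Longrightarrow> {x, y} \<in> edges p \<Longrightarrow> {x, y} \<in> edges q"
    and F: "\<And>x. x \<in> uncoloured n p \<Longrightarrow> forbidden p x = forbidden q x"
  shows "tame n k p"
proof -
  have "(\<Sum>x\<in>uncoloured n p. 2 ^ card (forbidden p x) :: nat) = (\<Sum>x\<in>uncoloured n p. 2 ^ card (forbidden q x))"
    by (rule sum.cong) (use F in auto)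
  also have "\<dots> \<le> (\<Sum>x\<in>uncoloured n q. 2 ^ card (forbidden q x) :: nat)"
    by (rule sum_mono2) (use U in auto)
  also have "\<dots> \<le> n"
    using tame by (simp add: tame_def)
  finally have S: "(\<Sum>x\<in>uncoloured n p. 2 ^ card (forbidden p x)) \<le> n" .
  have sub: "uncoloured n p \<subseteq> uncoloured n q"
    using U by auto
  show ?thesis
    unfolding tame_def
  proof (intro conjI ballI impI S)
    fix x y assume "x \<in> uncoloured n p" "y \<in> uncoloured n p"
    with tame sub E show "{x, y} \<notin> edges p"
      unfolding tame_def by blast
  next
    fix x assume "x \<in> uncoloured n p"
    with tame sub F show "card (forbidden p x) + 2 \<le> k"
      unfolding tame_def by (metis subsetD)
  next
    fix x y assume "x \<in> uncoloured n p" "y \<in> uncoloured n p"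
      "forbidden p x = forbidden p y \<and> card (forbidden p y) + 2 = k"
    with tame sub F show "x = y"
      unfolding tame_def by (metis subsetD)
  qed
qed

text \<open>Covers the reply that colours \<open>u\<close> and shows \<open>w\<close> one more
  colour: two equal terms \<open>2 ^ f\<close> become one term \<open>2 ^ (f + 1)\<close>, so the
  weight is unchanged. Distinctness is at risk only for the enlarged set at size
  \<open>k - 2\<close>, whence \<open>new\<close>.\<close>

lemma tame_replace:
  assumes tame: "tame n k q" and u: "u \<in> uncoloured n q" and w: "w \<in> uncoloured n q" and uw: "u \<noteq> w"
    and U: "uncoloured n p = uncoloured n q - {u}"
    and E: "\<And>x y. x \<in> uncoloured n p \<Longrightarrow> y \<in> uncoloured n p \<Longrightarrow> {x, y} \<in> edges p \<Longrightarrow> {x, y} \<in> edges q"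
    and F: "\<And>x. x \<in> uncoloured n p - {w} \<Longrightarrow> forbidden p x = forbidden q x"
    and same: "forbidden q u = forbidden q w"
    and Fw: "card (forbidden p w) = Suc (card (forbidden q w))"
    and le: "Suc (card (forbidden q w)) + 2 \<le> k"
    and new: "Suc (card (forbidden q w)) + 2 = k \<Longrightarrow>
      \<forall>x\<in>uncoloured n q - {u, w}. forbidden q x \<noteq> forbidden p w"
  shows "tame n k p"
proof -
  have Uq: "uncoloured n q = insert u (insert w (uncoloured n q - {u, w}))"
    using u w by auto
  have Up: "uncoloured n p = insert w (uncoloured n q - {u, w})"
    using U u w uw by auto
  have "(\<Sum>x\<in>uncoloured n p. 2 ^ card (forbidden p x) :: nat) =
      2 * 2 ^ card (forbidden q w) + (\<Sum>x\<in>uncoloured n q - {u, w}. 2 ^ card (forbidden p x))"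
    unfolding Up by (simp add: Fw)
  also have "(\<Sum>x\<in>uncoloured n q - {u, w}. 2 ^ card (forbidden p x) :: nat) =
      (\<Sum>x\<in>uncoloured n q - {u, w}. 2 ^ card (forbidden q x))"
    by (rule sum.cong) (use F Up in auto)
  also have "2 * 2 ^ card (forbidden q w) + \<dots> = (\<Sum>x\<in>uncoloured n q. 2 ^ card (forbidden q x) :: nat)"
    by (subst (2) Uq) (use uw same in simp)
  also have "\<dots> \<le> n"
    using tame by (simp add: tame_def)
  finally have S: "(\<Sum>x\<in>uncoloured n p. 2 ^ card (forbidden p x)) \<le> n" .
  have sub: "uncoloured n p \<subseteq> uncoloured n q"
    using U by auto
  show ?thesis
    unfolding tame_def
  proof (intro conjI ballI impI S)
    fix x y assume "x \<in> uncoloured n p" "y \<in> uncoloured n p"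
    with tame sub E show "{x, y} \<notin> edges p"
      unfolding tame_def by blast
  next
    fix x assume "x \<in> uncoloured n p"
    with tame sub F Fw le show "card (forbidden p x) + 2 \<le> k"
      unfolding tame_def by (cases "x = w") auto
  next
    fix x y assume xy: "x \<in> uncoloured n p" "y \<in> uncoloured n p"
      "forbidden p x = forbidden p y \<and> card (forbidden p y) + 2 = k"
    consider "x = w" "y = w" | "x = w" "y \<noteq> w" | "x \<noteq> w" "y = w" | "x \<noteq> w" "y \<noteq> w"
      by blast
    then show "x = y"
    proof cases
      case 2
      with xy Up new F[of y] Fw show ?thesis by auto
    next
      case 3
      with xy Up new F[of x] Fw show ?thesis by auto
    next
      case 4
      with xy F[of x] F[of y] have "forbidden q x = forbidden q y \<and> card (forbidden q y) + 2 = k"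
        by auto
      with tame sub xy(1,2) show ?thesis
        unfolding tame_def by blast
    qed auto
  qed
qed

text \<open>The cases count the uncoloured ends of Builder's edge; only two such ends with equal
  sets call for a careful colour. The alternative \<open>p = q\<close> serves the opening
  move.\<close>

lemma painter_reply:
  assumes q: "tame n k q" and s: "sound n k p"
    and qp: "p = q \<or> builder_move n q p" and ne: "uncoloured n p \<noteq> {}" and n: "n < 2 ^ k" and k: "3 \<le> k"
  shows "\<exists>p'. painter_move n k p p' \<and> tame n k p'"
proof -
  have reply: ?thesis if "v \<in> uncoloured n p" "i \<in> {1..k}" "i \<notin> forbidden p v"
    "tame n k (p\<lparr>colouring := (colouring p)(v \<mapsto> i)\<rparr>)" for v i
    using that painter_move_free[OF s, of v i] by (auto simp: forbidden_def uncoloured_def)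
  \<comment> \<open>At least two colours lie outside \<open>A\<close>, so one remains even beside
    the extra colour \<open>j\<close>.\<close>
  have free: "\<exists>i\<in>{1..k}. i \<notin> B" if "B \<subseteq> insert j A" "finite A" "card A + 2 \<le> k" for A B :: "nat set" and j
  proof (rule ccontr)
    assume "\<not> ?thesis"
    then have "{1..k} \<subseteq> insert j A"
      using that(1) by auto
    then have "k \<le> card (insert j A)"
      using card_mono[of "insert j A" "{1..k}"] that(2) by simp
    with card_insert_le_m1[of "card A + 1" A j] that(2,3) show False
      by (simp add: card_insert_if split: if_splits)
  qed
  \<comment> \<open>Without edges between uncoloured vertices, colouring \<open>v\<close> affects no
    other set; \<open>j\<close> is the colour that Builder's edge may just have shown to
    \<open>v\<close>.\<close>
  have isolated: ?thesis
    if v: "v \<in> uncoloured n p" and U: "uncoloured n q = uncoloured n p"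
      and F: "\<And>x. x \<in> uncoloured n p - {v} \<Longrightarrow> forbidden p x = forbidden q x"
      and Fv: "forbidden p v \<subseteq> insert j (forbidden q v)"
      and E: "\<And>x y. x \<in> uncoloured n p \<Longrightarrow> y \<in> uncoloured n p \<Longrightarrow> {x, y} \<notin> edges p" for v j
  proof -
    have fin: "finite (forbidden q v)" if "p = q \<or> builder_move n q p"
    proof (rule finite_subset)
      show "forbidden q v \<subseteq> forbidden p v"
        using that by (auto simp: builder_move_def forbidden_def)
    qed (rule finite_forbidden[OF s])
    obtain i where i: "i \<in> {1..k}" "i \<notin> forbidden p v"
      using free[OF Fv fin[OF qp]] q v U by (auto simp: tame_def)
    have "tame n k (p\<lparr>colouring := (colouring p)(v \<mapsto> i)\<rparr>)"
    proof (rule tame_remove[OF q])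
      fix x assume x: "x \<in> uncoloured n (p\<lparr>colouring := (colouring p)(v \<mapsto> i)\<rparr>)"
      then have "{v, x} \<notin> edges p"
        using E v by (auto simp: uncoloured_colour)
      moreover have "colouring p v = None"
        using v by (simp add: uncoloured_def)
      ultimately show "forbidden (p\<lparr>colouring := (colouring p)(v \<mapsto> i)\<rparr>) x = forbidden q x"
        using x F[of x] by (simp add: forbidden_colour uncoloured_colour)
    qed (use v U E in \<open>auto simp: uncoloured_colour\<close>)
    with reply i v show ?thesis by blast
  qed
  show ?thesis
  proof (cases "p = q")
    case True
    from ne obtain v where v: "v \<in> uncoloured n p" by auto
    \<comment> \<open>No colour is new to \<open>v\<close>, so 0 merely fills the slot of
      \<open>j\<close>.\<close>
    show ?thesis
      by (rule isolated[OF v, of 0]) (use True q in \<open>auto simp: tame_def\<close>)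
  next
    case False
    with qp obtain a b where ab: "a \<in> {1..n}" "b \<in> {1..n}" "a \<noteq> b" "{a, b} \<notin> edges q"
      and p: "p = q\<lparr>edges := insert {a, b} (edges q)\<rparr>"
      unfolding builder_move_def by blast
    have U: "uncoloured n q = uncoloured n p"
      by (simp add: p uncoloured_def)
    have F: "forbidden p x = forbidden q x" if "x \<notin> {a, b}" for x
      using that by (auto simp: p forbidden_def doubleton_eq_iff)
    have col: "forbidden p a = forbidden q a \<union> set_option (colouring q b)"
      "forbidden p b = forbidden q b \<union> set_option (colouring q a)"
      using ab(3) by (auto simp: p forbidden_def doubleton_eq_iff)
    have Eq: "{x, y} \<notin> edges q" if "x \<in> uncoloured n p" "y \<in> uncoloured n p" for x y
      using q that U by (auto simp: tame_def)
    have one: ?thesis if "a \<in> uncoloured n p" "b \<notin> uncoloured n p" "{a, b} \<in> edges p"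
      "p = q\<lparr>edges := insert {a, b} (edges q)\<rparr>" "a \<noteq> b" "b \<in> {1..n}" for a b
    proof -
      from that obtain j where j: "colouring q b = Some j"
        by (auto simp: uncoloured_def)
      show ?thesis
      proof (rule isolated[OF that(1) U, of j])
        fix x assume "x \<in> uncoloured n p - {a}"
        then show "forbidden p x = forbidden q x"
          using that by (auto simp: that(4) forbidden_def doubleton_eq_iff uncoloured_def)
      next
        show "forbidden p a \<subseteq> insert j (forbidden q a)"
          using that(5) j by (auto simp: that(4) forbidden_def doubleton_eq_iff)
      next
        fix x y assume "x \<in> uncoloured n p" "y \<in> uncoloured n p"
        with Eq that(2) show "{x, y} \<notin> edges p"
          by (auto simp: that(4) doubleton_eq_iff)
      qed
    qed
    \<comment> \<open>A colour seen by \<open>w\<close> but not by \<open>u\<close> is allowed for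
      \<open>u\<close> and adds nothing to the set of \<open>w\<close>.\<close>
    have two: ?thesis
      if u: "u \<in> uncoloured n p" and w: "w \<in> uncoloured n p" and uw: "u \<noteq> w" "{u, w} = {a, b}"
        and c: "c \<in> forbidden q w" "c \<notin> forbidden q u" for u w c
    proof -
      have Fq: "forbidden p x = forbidden q x" for x
        using that F col by (cases "x \<in> {a, b}") (auto simp: doubleton_eq_iff uncoloured_def p)
      have uw_edge: "{u, x} \<in> edges p \<longleftrightarrow> x = w" if "x \<in> uncoloured n p" for x
        using Eq[OF u that] uw by (auto simp: p doubleton_eq_iff)
      have "colouring p u = None"
        using u by (simp add: uncoloured_def)
      have "tame n k (p\<lparr>colouring := (colouring p)(u \<mapsto> c)\<rparr>)"
      proof (rule tame_remove[OF q, of u])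
        fix x y assume "x \<in> uncoloured n (p\<lparr>colouring := (colouring p)(u \<mapsto> c)\<rparr>)"
          "y \<in> uncoloured n (p\<lparr>colouring := (colouring p)(u \<mapsto> c)\<rparr>)"
          "{x, y} \<in> edges (p\<lparr>colouring := (colouring p)(u \<mapsto> c)\<rparr>)"
        then have "{x, y} \<in> edges p" "x \<noteq> u" "y \<noteq> u"
          by (simp_all add: uncoloured_colour)
        then show "{x, y} \<in> edges q"
          using uw by (auto simp: p doubleton_eq_iff)
      next
        fix x assume "x \<in> uncoloured n (p\<lparr>colouring := (colouring p)(u \<mapsto> c)\<rparr>)"
        then show "forbidden (p\<lparr>colouring := (colouring p)(u \<mapsto> c)\<rparr>) x = forbidden q x"
          using c(1) uw_edge[of x] Fq \<open>colouring p u = None\<close>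
          by (simp add: forbidden_colour uncoloured_colour insert_absorb)
      qed (use u U in \<open>simp_all add: uncoloured_colour\<close>)
      moreover have "c \<in> {1..k}"
        using c(1) forbidden_subset[OF s, of w] Fq[of w] by blast
      ultimately show ?thesis
        using reply[OF u] c(2) Fq[of u] by blast
    qed
    consider "a \<notin> uncoloured n p" "b \<notin> uncoloured n p"
      | "a \<in> uncoloured n p" "b \<notin> uncoloured n p"
      | "a \<notin> uncoloured n p" "b \<in> uncoloured n p"
      | "a \<in> uncoloured n p" "b \<in> uncoloured n p"
      by blast
    then show ?thesis
    proof cases
      case 1
      from ne obtain v where v: "v \<in> uncoloured n p" by auto
      show ?thesis
      proof (rule isolated[OF v U, of 0])
        fix x y assume "x \<in> uncoloured n p" "y \<in> uncoloured n p"
        with Eq 1 show "{x, y} \<notin> edges p"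
          by (auto simp: p doubleton_eq_iff)
      next
        fix x assume "x \<in> uncoloured n p - {v}"
        with 1 have "x \<notin> {a, b}" by auto
        then show "forbidden p x = forbidden q x" by (rule F)
      next
        have "v \<notin> {a, b}" using v 1 by auto
        from F[OF this] show "forbidden p v \<subseteq> insert 0 (forbidden q v)" by auto
      qed
    next
      case 2
      show ?thesis
        by (rule one[of a b]) (use 2 p ab in auto)
    next
      case 3
      show ?thesis
        by (rule one[of b a]) (use 3 p ab in \<open>auto simp: insert_commute\<close>)
    next
      case 4
      show ?thesis
      proof (cases "forbidden q a = forbidden q b")
        case False
        then consider c where "c \<in> forbidden q a" "c \<notin> forbidden q b"
          | c where "c \<in> forbidden q b" "c \<notin> forbidden q a"
          by blast
        then show ?thesis
          by cases (rule two[of b a] two[of a b]; use 4 ab in \<open>auto simp: insert_commute\<close>)+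
      next
        case same: True
        define B where "B = forbidden q b"
        have Fq: "forbidden p x = forbidden q x" for x
          using 4 F col by (cases "x \<in> {a, b}") (auto simp: uncoloured_def p)
        have Bk: "B \<subseteq> {1..k}" "finite B"
          using forbidden_subset[OF s, of b] finite_forbidden[OF s, of b] Fq by (auto simp: B_def)
        have le: "card B + 3 \<le> k"
        proof -
          have "card B + 2 \<le> k" "card B + 2 \<noteq> k"
            using q 4 U ab(3) same unfolding tame_def B_def by auto
          then show ?thesis by simp
        qed
        define C where "C = {1..k} - B"
        have C: "finite C" "card C = k - card B"
          using Bk by (auto simp: C_def card_Diff_subset)
        obtain c where c: "c \<in> C" and new: "card B + 3 = k \<Longrightarrow>
            \<forall>x\<in>uncoloured n q - {a, b}. forbidden q x \<noteq> insert c B"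
        proof (cases "card B + 3 = k")
          case False
          have "C \<noteq> {}"
            using C le by auto
          with False that show thesis by blast
        next
          case True
          \<comment> \<open>Otherwise the three colours of \<open>C\<close> yield three vertices of
            weight \<open>2 ^ (card B + 1)\<close>. Together with \<open>a\<close> and
            \<open>b\<close> the weight is at least \<open>8 * 2 ^ card B = 2 ^ k\<close>, against
            \<open>n < 2 ^ k\<close>.\<close>
          have "\<exists>c\<in>C. \<forall>x\<in>uncoloured n q - {a, b}. forbidden q x \<noteq> insert c B"
          proof (rule ccontr)
            assume "\<not> ?thesis"
            then have "\<forall>c\<in>C. \<exists>x. x \<in> uncoloured n q - {a, b} \<and> forbidden q x = insert c B"
              by auto
            then obtain g where g: "\<And>c. c \<in> C \<Longrightarrow> g c \<in> uncoloured n q - {a, b}"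
              "\<And>c. c \<in> C \<Longrightarrow> forbidden q (g c) = insert c B"
              by metis
            have inj: "inj_on g C"
            proof (rule inj_onI)
              fix c d assume cd: "c \<in> C" "d \<in> C" "g c = g d"
              then have "insert c B = insert d B"
                using g(2) by metis
              with cd(1,2) show "c = d"
                by (auto simp: C_def)
            qed
            have "card C = 3"
              using C(2) True by simp
            have sum_eq: "(\<Sum>x\<in>uncoloured n q. 2 ^ card (forbidden q x) :: nat) =
                (\<Sum>x\<in>uncoloured n q - {a, b}. 2 ^ card (forbidden q x)) + 2 * 2 ^ card B"
            proof -
              have "uncoloured n q = insert a (insert b (uncoloured n q - {a, b}))"
                using 4 U by auto
              moreover have "(\<Sum>x\<in>insert a (insert b (uncoloured n q - {a, b})). 2 ^ card (forbidden q x) :: nat) =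
                  (\<Sum>x\<in>uncoloured n q - {a, b}. 2 ^ card (forbidden q x)) + 2 * 2 ^ card B"
                using ab(3) same by (simp add: B_def)
              ultimately show ?thesis by simp
            qed
            have "card C * 2 ^ (card B + 1) = (\<Sum>c\<in>C. 2 ^ card (insert c B) :: nat)"
              using Bk(2) by (simp add: C_def card_insert_if)
            also have "\<dots> = (\<Sum>c\<in>C. 2 ^ card (forbidden q (g c)))"
              by (rule sum.cong) (use g(2) in auto)
            also have "\<dots> = (\<Sum>x\<in>g ` C. 2 ^ card (forbidden q x))"
              using sum.reindex[OF inj, of "\<lambda>x. 2 ^ card (forbidden q x) :: nat"] by simp
            also have "\<dots> \<le> (\<Sum>x\<in>uncoloured n q - {a, b}. 2 ^ card (forbidden q x))"
              by (rule sum_mono2) (use g in auto)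
            finally have "3 * 2 ^ (card B + 1) + 2 * 2 ^ card B \<le> n"
              using q \<open>card C = 3\<close> unfolding tame_def sum_eq by simp
            then have "2 ^ (card B + 3) \<le> n"
              by (simp add: power_add)
            with n True show False by simp
          qed
          with that show thesis by blast
        qed
        have cB: "c \<in> {1..k}" "c \<notin> B"
          using c by (auto simp: C_def)
        have ed: "{a, x} \<in> edges p \<longleftrightarrow> x = b" if "x \<in> uncoloured n p" for x
          using Eq[OF 4(1) that] ab(3) by (auto simp: p doubleton_eq_iff)
        define p' where "p' = p\<lparr>colouring := (colouring p)(a \<mapsto> c)\<rparr>"
        have Fp': "forbidden p' x = (if x = b then insert c B else forbidden q x)"
          if "x \<in> uncoloured n p" for x
          using 4 ed[OF that] Fq unfolding p'_def
          by (simp add: forbidden_colour uncoloured_def B_def)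
        have U': "uncoloured n p' = uncoloured n p - {a}"
          by (simp add: p'_def uncoloured_colour)
        have "tame n k p'"
        proof (rule tame_replace[OF q, of a b])
          fix x y assume "x \<in> uncoloured n p'" "y \<in> uncoloured n p'" "{x, y} \<in> edges p'"
          then have "{x, y} \<in> edges p" "x \<noteq> a" "y \<noteq> a"
            unfolding U' by (simp_all add: p'_def)
          then show "{x, y} \<in> edges q"
            by (auto simp: p doubleton_eq_iff)
        next
          show "card (forbidden p' b) = Suc (card (forbidden q b))"
            using Fp'[OF 4(2)] cB Bk(2) by (simp add: B_def)
        next
          fix x assume "x \<in> uncoloured n p' - {b}"
          then show "forbidden p' x = forbidden q x"
            unfolding U' using Fp'[of x] by simp
        next
          assume "Suc (card (forbidden q b)) + 2 = k"
          with new Fp'[OF 4(2)] show "\<forall>x\<in>uncoloured n q - {a, b}. forbidden q x \<noteq> forbidden p' b"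
            by (simp add: B_def)
        qed (use 4 U ab(3) same le U' in \<open>simp_all add: B_def\<close>)
        moreover have "c \<notin> forbidden p a"
          using cB same Fq by (auto simp: B_def)
        ultimately show ?thesis
          using reply[OF 4(1) cB(1)] by (simp add: p'_def)
      qed
    qed
  qed
qed

lemma painter_wins:
  assumes "n < 2 ^ k" "3 \<le> k"
  shows "\<exists>s. winning_strategy n k Painter s"
proof -
  \<comment> \<open>Builder may have joined two uncoloured vertices, so on Painter's turn the
    invariant refers to the preceding tame position \<open>q\<close>; \<open>p = q\<close> covers
    \<open>start\<close>.\<close>
  define K where "K w p = (case w of Builder \<Rightarrow> tame n k p
    | Painter \<Rightarrow> (\<exists>q. tame n k q \<and> sound n k q \<and> (p = q \<or> builder_move n q p)))" for w p
  obtain s where "winning_strategy n k Painter s"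
  proof (rule winning_strategy_from_invariant[of K Painter n k])
    show "K Painter start"
      unfolding K_def player.case using tame_start[OF assms(2)] sound_start by blast
  next
    fix p assume p: "K Painter p" "sound n k p" "\<not> game_over n k p"
    have "\<not> won n k Painter p"
      using p(3) unfolding game_over_def by blast
    then have "uncoloured n p \<noteq> {}"
      by (auto simp: uncoloured_def)
    moreover obtain q where "tame n k q" "p = q \<or> builder_move n q p"
      using p(1) unfolding K_def player.case by blast
    ultimately show "\<exists>p'. legal_move n k Painter p p' \<and> K (opponent Painter) p'"
      using painter_reply[OF _ p(2) _ _ assms]
      unfolding K_def player.case opponent.simps legal_move.simps by blast
  next
    fix p p' assume "K (opponent Painter) p" "sound n k p" "legal_move n k (opponent Painter) p p'"
    then show "K Painter p'"
      unfolding K_def player.case opponent.simps legal_move.simps by blast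
  next
    fix v p assume K: "K v p" and s: "sound n k p"
    have "\<not> won n k Builder p"
    proof (cases v)
      case Builder
      with K s show ?thesis
        unfolding K_def using tame_not_won by simp
    next
      case Painter
      with K obtain q where q: "tame n k q" "sound n k q" "p = q \<or> builder_move n q p"
        unfolding K_def by (simp only: player.case) blast
      \<comment> \<open>Had Builder's move won, Painter's reply would lead to a position both tame
        and won for Builder.\<close>
      show ?thesis
      proof
        assume "won n k Builder p"
        then have "uncoloured n p \<noteq> {}"
          unfolding won_Builder_forbidden by blast
        then obtain p' where "painter_move n k p p'" "tame n k p'"
          using painter_reply[OF q(1) s q(3)] assms by blast
        with painter_move_won_Builder \<open>won n k Builder p\<close> tame_not_won sound_move[OF s, of Painter] show False
          unfolding legal_move.simps by blast
      qed
    qed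
    then show "\<not> won n k (opponent Painter) p" by simp
  qed
  then show ?thesis by blast
qed

section \<open>Builder\<close>

text \<open>Here Builder is to move in \<open>p\<close>.\<close>

inductive forced :: "nat \<Rightarrow> nat \<Rightarrow> position \<Rightarrow> bool" for n k :: nat where
  forced_won: "won n k Builder p \<Longrightarrow> forced n k p"
| forced_step: "builder_move n p p' \<Longrightarrow> bipartite {1..n} (edges p') \<Longrightarrow>
    v \<in> {1..n} \<Longrightarrow> colouring p' v = None \<Longrightarrow>
    (\<And>p''. painter_move n k p' p'' \<Longrightarrow> forced n k p'') \<Longrightarrow> forced n k p"

text \<open>This is what the witness \<open>v\<close> in \<open>forced_step\<close> secures: a fully
  coloured position leaves Painter no move and would otherwise be forced vacuously.\<close>

lemma forced_uncoloured:
  assumes "forced n k p"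
  shows "\<not> won n k Painter p"
  using assms by cases (auto simp: builder_move_def)

lemma builder_wins_if_forced:
  assumes n: "0 < n" and forced: "\<And>p. painter_move n k start p \<Longrightarrow> forced n k p"
  shows "\<exists>s. winning_strategy n k Builder s \<and> keeps_bipartite n k Builder s"
proof -
  define K where "K w p = (bipartite {1..n} (edges p) \<and> (case w of Builder \<Rightarrow> forced n k p
    | Painter \<Rightarrow> \<not> won n k Painter p \<and> (\<forall>p'. painter_move n k p p' \<longrightarrow> forced n k p')))" for w p
  obtain s where s: "winning_strategy n k Builder s"
    and bip: "\<And>ps p. play n k ps \<Longrightarrow> follows Builder s ps \<Longrightarrow> p \<in> set ps \<Longrightarrow> \<exists>v. K v p"
  proof (rule winning_strategy_from_invariant[of K Builder n k])
    have "bipartite {1..n} (edges start)"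
      by (auto simp: bipartite_def start_def)
    moreover have "\<not> won n k Painter start"
      using n by (auto simp: start_def intro!: bexI[of _ 1])
    ultimately show "K Painter start"
      using forced by (simp add: K_def del: won.simps)
  next
    fix p assume p: "K Builder p" "\<not> game_over n k p"
    then have "forced n k p" "\<not> won n k Builder p"
      unfolding K_def game_over_def by (simp_all del: won.simps)
    then show "\<exists>p'. legal_move n k Builder p p' \<and> K (opponent Builder) p'"
    proof cases
      case (forced_step p' v)
      then have "\<not> won n k Painter p'"
        by auto
      with forced_step show ?thesis
        by (auto simp: K_def simp del: won.simps)
    qed (simp del: won.simps)
  next
    fix p p' assume "K (opponent Builder) p" "legal_move n k (opponent Builder) p p'"
    then show "K Builder p'"
      by (auto simp: K_def painter_move_def)
  next
    fix v p assume "K v p"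
    then show "\<not> won n k (opponent Builder) p"
      using forced_uncoloured by (cases v) (auto simp: K_def simp del: won.simps)
  qed blast
  have "keeps_bipartite n k Builder s"
    using bip unfolding keeps_bipartite_def K_def by blast
  with s show ?thesis
    by blast
qed

section \<open>Labelled blocks and joining them\<close>

text \<open>The labelling \<open>L\<close> groups the vertices into blocks closed under adjacency, and \<open>S\<close> is one side of a
  bipartition. Builder always joins two different blocks.\<close>

definition bisected :: "nat \<Rightarrow> nat set set \<Rightarrow> (nat \<Rightarrow> nat) \<Rightarrow> (nat \<Rightarrow> bool) \<Rightarrow> bool" where
  "bisected n E L S \<longleftrightarrow> (\<forall>e\<in>E. \<exists>a\<in>{1..n}. \<exists>b\<in>{1..n}. e = {a, b} \<and> L a = L b \<and> S a \<and> \<not> S b)"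

definition blocks :: "nat \<Rightarrow> nat \<Rightarrow> position \<Rightarrow> (nat \<Rightarrow> nat) \<Rightarrow> bool" where
  "blocks n k p L \<longleftrightarrow> properly_coloured p \<and>
     (\<forall>v i. colouring p v = Some i \<longrightarrow> v \<in> {1..n} \<and> i \<in> {1..k}) \<and>
     (\<exists>S. bisected n (edges p) L S)"

text \<open>The label of \<open>x\<close> survives and only that of \<open>y\<close> disappears, so
  labels recorded for other blocks stay valid.\<close>

definition merge :: "(nat \<Rightarrow> nat) \<Rightarrow> nat \<Rightarrow> nat \<Rightarrow> nat \<Rightarrow> nat" where
  "merge L x y v = (if L v = L y then L x else L v)"

definition join :: "position \<Rightarrow> nat \<Rightarrow> nat \<Rightarrow> position" where
  "join p x y = p\<lparr>edges := insert {x, y} (edges p)\<rparr>"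

lemma join_simps [simp]:
  "colouring (join p x y) = colouring p" "edges (join p x y) = insert {x, y} (edges p)"
  by (simp_all add: join_def)

lemma blocks_edge:
  assumes "blocks n k p L" "{u, v} \<in> edges p"
  shows "L u = L v" "u \<noteq> v" "u \<in> {1..n}" "v \<in> {1..n}"
  using assms by (fastforce simp: blocks_def bisected_def doubleton_eq_iff)+

lemma blocks_dom: "blocks n k p L \<Longrightarrow> dom (colouring p) \<subseteq> {1..n}"
  unfolding blocks_def by blast

lemma blocks_painter_move:
  assumes "blocks n k p L" "painter_move n k p p'"
  shows "blocks n k p' L" "card (dom (colouring p')) = Suc (card (dom (colouring p)))"
proof -
  obtain v i where v: "v \<in> {1..n}" "i \<in> {1..k}" "colouring p v = None"
    "p' = p\<lparr>colouring := (colouring p)(v \<mapsto> i)\<rparr>" "properly_coloured p'"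
    using assms(2) unfolding painter_move_def by blast
  then show "blocks n k p' L"
    using assms(1) unfolding blocks_def by simp
  have "dom (colouring p) \<subseteq> {1..n}"
    by (rule blocks_dom[OF assms(1)])
  then have "finite (dom (colouring p))"
    by (rule finite_subset) simp
  with v show "card (dom (colouring p')) = Suc (card (dom (colouring p)))"
    by (simp add: domIff)
qed

text \<open>An uncoloured \<open>x\<close> makes the edge legal. As it runs between different
  blocks, their sides can be flipped independently. Only the label \<open>L y\<close> is at stake,
  so at most one block is lost.\<close>

lemma blocks_join:
  assumes p: "blocks n k p L" and xy: "x \<in> {1..n}" "y \<in> {1..n}" "L x \<noteq> L y" and x: "colouring p x = None"
  shows "blocks n k (join p x y) (merge L x y)" "builder_move n p (join p x y)"
    "bipartite {1..n} (edges (join p x y))" "card (L ` {1..n}) \<le> Suc (card (merge L x y ` {1..n}))"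
proof -
  have new: "{x, y} \<notin> edges p"
    using blocks_edge(1)[OF p, of x y] xy(3) by auto
  have "properly_coloured p"
    using p by (simp add: blocks_def)
  then have proper: "properly_coloured (join p x y)"
    using x unfolding properly_coloured_def join_simps by (metis doubleton_eq_iff insertE option.distinct(1))
  have "x \<noteq> y"
    using xy(3) by auto
  with new xy proper show "builder_move n p (join p x y)"
    unfolding builder_move_def by (intro bexI[of _ x] bexI[of _ y]) (simp_all add: join_def)
  obtain S where S: "bisected n (edges p) L S"
    using p unfolding blocks_def by blast
  \<comment> \<open>The block of \<open>y\<close> is flipped, if necessary, to put \<open>y\<close>
    on the true side, and all other blocks together to put \<open>x\<close> on the false side.
    Opposite sides within a block stay opposite.\<close>
  define S' where "S' v = (if L v = L y then S v = S y else S v \<noteq> S x)" for v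
  have S'_edge: "\<exists>a\<in>{1..n}. \<exists>b\<in>{1..n}. e = {a, b} \<and> L a = L b \<and> S' a \<and> \<not> S' b" if "e \<in> edges p" for e
  proof -
    from bspec[OF S[unfolded bisected_def] that] obtain a b where ab: "a \<in> {1..n}" "b \<in> {1..n}" "e = {a, b}" "L a = L b" "S a" "\<not> S b"
      by blast
    then have "S' a \<noteq> S' b"
      by (auto simp: S'_def)
    then consider "S' a" "\<not> S' b" | "S' b" "\<not> S' a"
      by blast
    then show ?thesis
    proof cases
      case 1
      with ab show ?thesis by blast
    next
      case 2
      moreover have "e = {b, a}" "L b = L a"
        using ab by auto
      ultimately show ?thesis
        using ab(1,2) by blast
    qed
  qed
  have S': "\<exists>a\<in>{1..n}. \<exists>b\<in>{1..n}. e = {a, b} \<and> merge L x y a = merge L x y b \<and> S' a \<and> \<not> S' b"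
    if e: "e \<in> edges (join p x y)" for e
  proof (cases "e \<in> edges p")
    case True
    from S'_edge[OF this] obtain a b where "a \<in> {1..n}" "b \<in> {1..n}" "e = {a, b}" "L a = L b" "S' a" "\<not> S' b"
      by blast
    moreover from this have "merge L x y a = merge L x y b"
      by (simp add: merge_def)
    ultimately show ?thesis by blast
  next
    case False
    with e have "e = {y, x}"
      by auto
    with xy show ?thesis
      by (intro bexI[of _ y] bexI[of _ x]) (auto simp: merge_def S'_def)
  qed
  then have "bisected n (edges (join p x y)) (merge L x y) S'"
    unfolding bisected_def by blast
  with p proper show "blocks n k (join p x y) (merge L x y)"
    unfolding blocks_def by auto
  show "bipartite {1..n} (edges (join p x y))"
    unfolding bipartite_def
  proof (intro exI conjI ballI)
    show "{v \<in> {1..n}. S' v} \<union> {v \<in> {1..n}. \<not> S' v} = {1..n}" "{v \<in> {1..n}. S' v} \<inter> {v \<in> {1..n}. \<not> S' v} = {}"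
      by auto
    fix e assume "e \<in> edges (join p x y)"
    from S'[OF this] show "\<exists>a\<in>{v \<in> {1..n}. S' v}. \<exists>b\<in>{v \<in> {1..n}. \<not> S' v}. e = {a, b}"
      by blast
  qed
  have "L ` {1..n} \<subseteq> insert (L y) (merge L x y ` {1..n})"
    by (auto simp: merge_def image_iff)
  then have "card (L ` {1..n}) \<le> card (insert (L y) (merge L x y ` {1..n}))"
    by (intro card_mono) auto
  also have "\<dots> \<le> Suc (card (merge L x y ` {1..n}))"
    by (rule card_insert_le_m1) auto
  finally show "card (L ` {1..n}) \<le> Suc (card (merge L x y ` {1..n}))" .
qed

text \<open>In each round one block is lost and one vertex is coloured, so the inequality is preserved.\<close>

definition open_blocks :: "nat \<Rightarrow> nat \<Rightarrow> position \<Rightarrow> (nat \<Rightarrow> nat) \<Rightarrow> bool" where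
  "open_blocks n k p L \<longleftrightarrow> blocks n k p L \<and> n < card (L ` {1..n}) + card (dom (colouring p))"

text \<open>One round as an induction step: a join, then any answer of Painter. The last premise of
  \<open>step\<close> is the decrease in uncoloured vertices on which both phases recurse.\<close>

lemma forced_join:
  assumes p: "open_blocks n k p L" and xy: "x \<in> {1..n}" "y \<in> {1..n}" "L x \<noteq> L y" and x: "colouring p x = None"
    and step: "\<And>p'. painter_move n k (join p x y) p' \<Longrightarrow> open_blocks n k p' (merge L x y) \<Longrightarrow>
      n - card (dom (colouring p')) < n - card (dom (colouring p)) \<Longrightarrow> forced n k p'"
  shows "forced n k p"
proof -
  have b: "blocks n k p L" and c: "n < card (L ` {1..n}) + card (dom (colouring p))"
    using p by (auto simp: open_blocks_def)
  note J = blocks_join[OF b xy x]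
  have "dom (colouring p) \<subseteq> {1..n}"
    by (rule blocks_dom[OF b])
  then have "dom (colouring p) \<subset> {1..n}"
    using x xy(1) by (metis domIff psubsetI)
  from psubset_card_mono[OF _ this] have less: "card (dom (colouring p)) < n"
    by simp
  show ?thesis
  proof (rule forced_step[OF J(2,3) xy(1)])
    fix p' assume m: "painter_move n k (join p x y) p'"
    note M = blocks_painter_move[OF J(1) m]
    show "forced n k p'"
    proof (rule step[OF m])
      show "open_blocks n k p' (merge L x y)"
        unfolding open_blocks_def using M J(4) c by simp
    qed (use M less in simp)
  qed (use x in simp)
qed

text \<open>Blocks of level \<open>j\<close>: the vertices that Builder works with see \<open>j\<close> colours, and a tool shows
  \<open>j + 1\<close> colours, hence one that a given vertex of level \<open>j\<close> does not see.\<close>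

definition sees :: "nat \<Rightarrow> position \<Rightarrow> nat set \<Rightarrow> nat \<Rightarrow> bool" where
  "sees n p F v \<longleftrightarrow> v \<in> {1..n} \<and> colouring p v = None \<and>
     (\<forall>c\<in>F. \<exists>u. {u, v} \<in> edges p \<and> colouring p u = Some c)"

definition palettes :: "nat \<Rightarrow> nat \<Rightarrow> nat set set" where
  "palettes k j = {F. F \<subseteq> {1..k} \<and> card F = j}"

definition single :: "nat \<Rightarrow> nat \<Rightarrow> nat \<Rightarrow> position \<Rightarrow> (nat \<Rightarrow> nat) \<Rightarrow> nat \<Rightarrow> bool" where
  "single n k j p L b \<longleftrightarrow> (\<exists>v. L v = b \<and> (\<exists>F\<in>palettes k j. sees n p F v))"

definition pair :: "nat \<Rightarrow> nat \<Rightarrow> nat \<Rightarrow> position \<Rightarrow> (nat \<Rightarrow> nat) \<Rightarrow> nat \<Rightarrow> bool" where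
  "pair n k j p L b \<longleftrightarrow> (\<exists>u w. L u = b \<and> L w = b \<and> {u, w} \<in> edges p \<and>
     (\<exists>F\<in>palettes k j. sees n p F u \<and> sees n p F w))"

definition lifted :: "nat \<Rightarrow> nat \<Rightarrow> nat \<Rightarrow> position \<Rightarrow> (nat \<Rightarrow> nat) \<Rightarrow> nat \<Rightarrow> bool" where
  "lifted n k j p L b \<longleftrightarrow> (\<exists>u w. L u = b \<and> L w = b \<and> {u, w} \<in> edges p \<and>
     (\<exists>F\<in>palettes k j. \<exists>c\<in>{1..k} - F. sees n p (insert c F) u \<and> sees n p F w))"

definition tool :: "nat \<Rightarrow> nat \<Rightarrow> nat \<Rightarrow> position \<Rightarrow> (nat \<Rightarrow> nat) \<Rightarrow> nat \<Rightarrow> bool" where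
  "tool n k j p L b \<longleftrightarrow> (\<exists>F\<in>palettes k (Suc j). \<forall>c\<in>F. \<exists>v\<in>{1..n}. L v = b \<and> colouring p v = Some c)"

section \<open>Effect of one move on a block\<close>

lemma palettes_insert: "F \<in> palettes k j \<Longrightarrow> c \<in> {1..k} - F \<Longrightarrow> insert c F \<in> palettes k (Suc j)"
  using finite_subset[of F "{1..k}"] by (auto simp: palettes_def card_insert_if)

lemma sees_join: "sees n p F v \<Longrightarrow> sees n (join p x y) F v"
  by (auto simp: sees_def)

lemma join_frame:
  assumes "b \<noteq> L y"
  shows "single n k j p L b \<Longrightarrow> single n k j (join p x y) (merge L x y) b"
    "pair n k j p L b \<Longrightarrow> pair n k j (join p x y) (merge L x y) b"
    "lifted n k j p L b \<Longrightarrow> lifted n k j (join p x y) (merge L x y) b"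
    "tool n k j p L b \<Longrightarrow> tool n k j (join p x y) (merge L x y) b"
proof -
  have L: "merge L x y v = b" if "L v = b" for v
    using that assms by (simp add: merge_def)
  show "single n k j p L b \<Longrightarrow> single n k j (join p x y) (merge L x y) b"
    unfolding single_def using L sees_join by blast
  show "pair n k j p L b \<Longrightarrow> pair n k j (join p x y) (merge L x y) b"
    unfolding pair_def join_simps using L sees_join by (metis insertCI)
  show "lifted n k j p L b \<Longrightarrow> lifted n k j (join p x y) (merge L x y) b"
    unfolding lifted_def join_simps using L sees_join by (metis insertCI)
  show "tool n k j p L b \<Longrightarrow> tool n k j (join p x y) (merge L x y) b"
    unfolding tool_def join_simps using L by meson
qed

context
  fixes n k :: nat and p p' :: position and L :: "nat \<Rightarrow> nat" and v i :: nat
  assumes p: "blocks n k p L"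
    and v: "v \<in> {1..n}" "i \<in> {1..k}" "colouring p v = None" "properly_coloured p'"
    and p': "p' = p\<lparr>colouring := (colouring p)(v \<mapsto> i)\<rparr>"
begin

lemma sees_colour: "u \<noteq> v \<Longrightarrow> sees n p F u \<Longrightarrow> sees n p' F u"
  using v(3) unfolding sees_def p' by (auto; metis option.distinct(1))

text \<open>Properness of \<open>p'\<close> keeps \<open>i\<close> out of every palette that
  \<open>v\<close> sees, so adding \<open>i\<close> raises the level by one.\<close>

lemma sees_new_colour: "sees n p F v \<Longrightarrow> i \<notin> F"
proof
  assume "sees n p F v" "i \<in> F"
  then obtain u where "{u, v} \<in> edges p" "colouring p u = Some i"
    by (auto simp: sees_def)
  with v(3) have "{u, v} \<in> edges p'" "colouring p' u = Some i" "colouring p' v = Some i"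
    by (auto simp: p')
  with v(4) show False
    unfolding properly_coloured_def by blast
qed

lemma sees_neighbour:
  assumes "sees n p F w" "{v, w} \<in> edges p"
  shows "sees n p' (insert i F) w"
proof -
  have "w \<noteq> v"
    using blocks_edge(2)[OF p assms(2)] by auto
  from sees_colour[OF this assms(1)] show ?thesis
    using assms(2) by (auto simp: sees_def p')
qed

lemma tool_colour: "tool n k j p L b \<Longrightarrow> tool n k j p' L b"
  using v(3) unfolding tool_def p' by (simp; metis option.distinct(1))

lemma frame_colour:
  assumes "b \<noteq> L v"
  shows "single n k j p L b \<Longrightarrow> single n k j p' L b"
    "pair n k j p L b \<Longrightarrow> pair n k j p' L b"
    "lifted n k j p L b \<Longrightarrow> lifted n k j p' L b"
proof -
  have E: "edges p' = edges p"
    by (simp add: p')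
  have *: "sees n p' F u" if "L u = b" "sees n p F u" for F u
    using that assms sees_colour[of u F] by auto
  show "single n k j p L b \<Longrightarrow> single n k j p' L b"
    unfolding single_def using * by blast
  show "pair n k j p L b \<Longrightarrow> pair n k j p' L b"
    unfolding pair_def E using * by blast
  show "lifted n k j p L b \<Longrightarrow> lifted n k j p' L b"
    unfolding lifted_def E using * by blast
qed

text \<open>If the witness itself is coloured, its neighbours with the \<open>j\<close> seen colours
  lie in its block, which together with \<open>i\<close> displays \<open>j + 1\<close>
  colours.\<close>

lemma single_colour: "single n k j p L b \<Longrightarrow> single n k j p' L b \<or> tool n k j p' L b"
proof -
  assume "single n k j p L b"
  then obtain u F where u: "L u = b" "F \<in> palettes k j" "sees n p F u"
    unfolding single_def by blast
  show ?thesis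
  proof (cases "u = v")
    case False
    with u sees_colour show ?thesis
      unfolding single_def by blast
  next
    case True
    have "\<exists>x\<in>{1..n}. L x = b \<and> colouring p' x = Some c" if "c \<in> insert i F" for c
    proof (cases "c = i")
      case True
      with v u \<open>u = v\<close> show ?thesis
        by (intro bexI[of _ v]) (auto simp: p')
    next
      case False
      with that u True obtain x where x: "{x, v} \<in> edges p" "colouring p x = Some c"
        by (auto simp: sees_def)
      then show ?thesis
        using blocks_edge[OF p x(1)] u(1) True
        by (intro bexI[of _ x]) (auto simp: p')
    qed
    moreover have "insert i F \<in> palettes k (Suc j)"
      using palettes_insert u v sees_new_colour True by auto
    ultimately show ?thesis
      unfolding tool_def by blast
  qed
qed

text \<open>Colouring one end shows \<open>i\<close> to the other, and \<open>i\<close> is outside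
  the common palette because the coloured end saw all of it.\<close>

lemma pair_colour: "pair n k j p L b \<Longrightarrow> pair n k j p' L b \<or> single n k (Suc j) p' L b"
proof -
  assume "pair n k j p L b"
  then obtain u w F where u: "L u = b" "L w = b" "{u, w} \<in> edges p" "F \<in> palettes k j"
    "sees n p F u" "sees n p F w"
    unfolding pair_def by blast
  have lift: "single n k (Suc j) p' L b" if "{v, x} \<in> edges p" "L x = b" "sees n p F x" "sees n p F v" for x
    using that sees_neighbour palettes_insert[OF u(4), of i] sees_new_colour v(2)
    unfolding single_def by (metis DiffI)
  consider "u = v" | "w = v" | "u \<noteq> v" "w \<noteq> v" by blast
  then show ?thesis
  proof cases
    case 3
    have "{u, w} \<in> edges p'"
      using u(3) by (simp add: p')
    with u 3 sees_colour show ?thesis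
      unfolding pair_def by blast
  qed (use u lift[of w] lift[of u] in \<open>auto simp: insert_commute\<close>)
qed

text \<open>Colouring \<open>u\<close> shows \<open>w\<close> a colour outside \<open>F\<close>;
  colouring \<open>w\<close> leaves \<open>u\<close> with its \<open>j + 1\<close> colours.\<close>

lemma lifted_colour: "lifted n k j p L b \<Longrightarrow> lifted n k j p' L b \<or> single n k (Suc j) p' L b"
proof -
  assume "lifted n k j p L b"
  then obtain u w F c where u: "L u = b" "L w = b" "{u, w} \<in> edges p" "F \<in> palettes k j" "c \<in> {1..k} - F"
    "sees n p (insert c F) u" "sees n p F w"
    unfolding lifted_def by blast
  consider "u = v" | "u \<noteq> v" "w = v" | "u \<noteq> v" "w \<noteq> v" by blast
  then show ?thesis
  proof cases
    case 1
    have "insert i F \<in> palettes k (Suc j)"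
      using palettes_insert[OF u(4), of i] sees_new_colour u(6) v(2) 1 by blast
    moreover have "sees n p' (insert i F) w"
      using sees_neighbour u(3,7) 1 by blast
    ultimately show ?thesis
      using u(2) unfolding single_def by blast
  next
    case 2
    then have "sees n p' (insert c F) u"
      using sees_colour u(6) by blast
    with u(1) palettes_insert[OF u(4,5)] show ?thesis
      unfolding single_def by blast
  next
    case 3
    have "{u, w} \<in> edges p'"
      using u(3) by (simp add: p')
    moreover have "sees n p' (insert c F) u" "sees n p' F w"
      using 3 u sees_colour by blast+
    ultimately show ?thesis
      using u unfolding lifted_def by blast
  qed
qed

end

lemma lifted_single: "lifted n k j p L b \<Longrightarrow> single n k (Suc j) p L b"
  unfolding lifted_def single_def using palettes_insert by blast

section \<open>Lifting pairs with tools\<close>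

text \<open>The pairs \<open>P\<close> are lifted with the tools \<open>T\<close>. Painter needs two moves to spoil a lifted pair, so
  \<open>2 * card R + card D\<close> grows in each round.\<close>

lemma raise_phase:
  assumes up: "\<And>p L B. open_blocks n k p L \<Longrightarrow> finite B \<Longrightarrow> m \<le> card B \<Longrightarrow>
      \<forall>b\<in>B. single n k (Suc j) p L b \<Longrightarrow> forced n k p"
    and "open_blocks n k p L" and "finite P" "finite T" "finite R" "finite D"
    and "P \<inter> T = {}" "P \<inter> R = {}" "P \<inter> D = {}" "T \<inter> R = {}" "T \<inter> D = {}" "R \<inter> D = {}"
    and "\<forall>b\<in>P. pair n k j p L b" "\<forall>b\<in>T. tool n k j p L b" "\<forall>b\<in>R. lifted n k j p L b"
      "\<forall>b\<in>D. single n k (Suc j) p L b"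
    and "2 * m \<le> card P + 2 * card R + card D" "2 * m \<le> card T + 2 * card R + card D"
  shows "forced n k p"
  using assms(2-)
proof (induction "n - card (dom (colouring p))" arbitrary: p L P T R D rule: less_induct)
  case less
  note ob = less.prems(1) and fin = less.prems(2-5) and disj = less.prems(6-11)
    and blk = less.prems(12-15) and cnt = less.prems(16,17)
  show ?case
  \<comment> \<open>A lifted block already contains a vertex that sees \<open>j + 1\<close> colours,
    so \<open>R\<close> counts along with \<open>D\<close>.\<close>
  proof (cases "m \<le> card (R \<union> D)")
    case True
    show ?thesis
      by (rule up[OF ob _ True]) (use fin blk lifted_single in auto)
  next
    case False
    with fin disj(6) have lt: "card R + card D < m"
      by (simp add: card_Un_disjoint)
    with cnt have "P \<noteq> {}" "T \<noteq> {}"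
      by auto
    then obtain b t where b: "b \<in> P" and t: "t \<in> T"
      by blast
    from b blk(1) obtain u w F where u: "L u = b" "L w = b" "{u, w} \<in> edges p" "F \<in> palettes k j"
      "sees n p F u" "sees n p F w"
      unfolding pair_def by blast
    from t blk(2) obtain C where C: "C \<in> palettes k (Suc j)"
      "\<forall>c\<in>C. \<exists>v\<in>{1..n}. L v = t \<and> colouring p v = Some c"
      unfolding tool_def by blast
    have "finite F" "card F < card C"
      using u(4) C(1) finite_subset[of F "{1..k}"] by (auto simp: palettes_def)
    then have "\<not> C \<subseteq> F"
      using card_mono[of F C] by auto
    then obtain c where c: "c \<in> C" "c \<notin> F"
      by blast
    with C obtain y where y: "y \<in> {1..n}" "L y = t" "colouring p y = Some c"
      by blast
    have ck: "c \<in> {1..k} - F"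
      using c C(1) by (auto simp: palettes_def)
    have bt: "b \<noteq> t"
      using b t disj(1) by auto
    define q where "q = join p u y"
    define L' where "L' = merge L u y"
    define P0 T0 R0 where "P0 = P - {b}" and "T0 = T - {t}" and "R0 = insert b R"
    have "lifted n k j q L' b"
      unfolding lifted_def
    proof (intro exI bexI conjI)
      show "L' u = b" "L' w = b"
        using u y bt by (auto simp: L'_def merge_def)
      show "{u, w} \<in> edges q"
        using u(3) by (simp add: q_def)
      have "{y, u} \<in> edges q"
        by (simp add: q_def insert_commute)
      then show "sees n q (insert c F) u"
        using u(5) y(3) by (auto simp: sees_def q_def)
      show "sees n q F w"
        using u(6) sees_join by (simp add: q_def)
    qed (use u(4) ck in auto)
    moreover have "b' \<noteq> L y" if "b' \<in> P0 \<union> T0 \<union> R \<union> D" for b'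
      using that y(2) t disj by (auto simp: P0_def T0_def)
    ultimately have blk0: "\<forall>b\<in>P0. pair n k j q L' b" "\<forall>b\<in>T0. tool n k j q L' b"
      "\<forall>b\<in>R0. lifted n k j q L' b" "\<forall>b\<in>D. single n k (Suc j) q L' b"
      using blk join_frame[of _ L y n k _ p u] unfolding q_def L'_def R0_def P0_def T0_def by simp_all
    have disj0: "P0 \<inter> T0 = {}" "P0 \<inter> R0 = {}" "P0 \<inter> D = {}" "T0 \<inter> R0 = {}" "T0 \<inter> D = {}" "R0 \<inter> D = {}"
      using disj b by (auto simp: P0_def T0_def R0_def)
    have fin0: "finite P0" "finite T0" "finite R0"
      using fin by (auto simp: P0_def T0_def R0_def)
    have "b \<notin> R"
      using b disj by auto
    then have "card P0 + 1 = card P" "card T0 + 1 = card T" "card R0 = card R + 1"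
      using card_Suc_Diff1[OF fin(1) b] card_Suc_Diff1[OF fin(2) t] fin(3)
      by (simp_all add: P0_def T0_def R0_def)
    \<comment> \<open>Moving \<open>b\<close> from \<open>P\<close> to \<open>R\<close> and using up
      \<open>t\<close> raises both sums by one. This slack pays for Painter's move, which lowers
      each by at most one.\<close>
    with cnt have cnt0: "2 * m + 1 \<le> card P0 + 2 * card R0 + card D" "2 * m + 1 \<le> card T0 + 2 * card R0 + card D"
      by auto
    have xy: "u \<in> {1..n}" "L u \<noteq> L y" "colouring p u = None"
      using u y bt by (auto simp: sees_def)
    show ?thesis
    proof (rule forced_join[OF ob xy(1) y(1) xy(2,3)])
      fix p' assume m: "painter_move n k (join p u y) p'"
        and ob': "open_blocks n k p' (merge L u y)"
        and dec: "n - card (dom (colouring p')) < n - card (dom (colouring p))"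
      note IH = less.hyps[OF dec ob'[folded L'_def]]
      have bq: "blocks n k q L'"
        using blocks_join(1)[OF _ xy(1) y(1) xy(2,3)] ob unfolding q_def L'_def open_blocks_def by blast
      from m obtain v i where v: "v \<in> {1..n}" "i \<in> {1..k}" "colouring q v = None" "properly_coloured p'"
        and p': "p' = q\<lparr>colouring := (colouring q)(v \<mapsto> i)\<rparr>"
        unfolding q_def painter_move_def by blast
      note col = bq v p'
      have T': "\<forall>b\<in>T0. tool n k j p' L' b"
        using blk0(2) tool_colour[OF col] by blast
      have fr: "\<forall>b\<in>P0 - {L' v}. pair n k j p' L' b" "\<forall>b\<in>R0 - {L' v}. lifted n k j p' L' b"
        "\<forall>b\<in>D - {L' v}. single n k (Suc j) p' L' b"
        using blk0 frame_colour[OF col] by blast+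
      consider "L' v \<in> P0" "\<not> pair n k j p' L' (L' v)" | "L' v \<in> R0" "\<not> lifted n k j p' L' (L' v)"
        | "L' v \<in> D" "\<not> single n k (Suc j) p' L' (L' v)"
        | "L' v \<in> P0 \<Longrightarrow> pair n k j p' L' (L' v)" "L' v \<in> R0 \<Longrightarrow> lifted n k j p' L' (L' v)"
          "L' v \<in> D \<Longrightarrow> single n k (Suc j) p' L' (L' v)"
        by blast
      then show "forced n k p'"
      proof cases
        case 1
        then have "single n k (Suc j) p' L' (L' v)"
          using pair_colour[OF col] blk0(1) by blast
        moreover have "L' v \<notin> R0" "L' v \<notin> D" "L' v \<notin> T0"
          using 1 disj0 by auto
        ultimately show ?thesis
          using fr fin fin0 disj0 cnt0 T' card_Suc_Diff1[OF fin0(1) 1(1)]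
          by (intro IH[of "P0 - {L' v}" T0 R0 "insert (L' v) D"]) auto
      next
        case 2
        then have "single n k (Suc j) p' L' (L' v)"
          using lifted_colour[OF col] blk0(3) by blast
        moreover have "L' v \<notin> P0" "L' v \<notin> D" "L' v \<notin> T0"
          using 2 disj0 by auto
        ultimately show ?thesis
          using fr fin fin0 disj0 cnt0 T' card_Suc_Diff1[OF fin0(3) 2(1)]
          by (intro IH[of P0 T0 "R0 - {L' v}" "insert (L' v) D"]) auto
      next
        case 3
        have "L' v \<notin> P0" "L' v \<notin> R0" "L' v \<notin> T0"
          using 3 disj0 by auto
        then show ?thesis
          using fr fin fin0 disj0 cnt0 T' card_Suc_Diff1[OF fin(4) 3(1)]
          by (intro IH[of P0 T0 R0 "D - {L' v}"]) auto
      next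
        case 4
        with fr have "\<forall>b\<in>P0. pair n k j p' L' b" "\<forall>b\<in>R0. lifted n k j p' L' b" "\<forall>b\<in>D. single n k (Suc j) p' L' b"
          by blast+
        then show ?thesis
          using fin fin0 disj0 cnt0 T' by (intro IH[of P0 T0 R0 D]) auto
      qed
    qed
  qed
qed

section \<open>Pairing blocks and collecting tools\<close>

definition pairing :: "nat \<Rightarrow> nat \<Rightarrow> nat \<Rightarrow> position \<Rightarrow> (nat \<Rightarrow> nat) \<Rightarrow>
    nat set \<Rightarrow> nat set \<Rightarrow> nat set \<Rightarrow> nat set \<Rightarrow> bool" where
  "pairing n k j p L A P D T \<longleftrightarrow> finite A \<and> finite P \<and> finite D \<and> finite T \<and>
     A \<inter> P = {} \<and> A \<inter> D = {} \<and> A \<inter> T = {} \<and> P \<inter> D = {} \<and> P \<inter> T = {} \<and> D \<inter> T = {} \<and>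
     (\<forall>b\<in>A. single n k j p L b) \<and> (\<forall>b\<in>P. pair n k j p L b) \<and>
     (\<forall>b\<in>D. single n k (Suc j) p L b) \<and> (\<forall>b\<in>T. tool n k j p L b)"

text \<open>A spoiled block of \<open>D\<close> is a tool of the next level; dropping a colour lets
  it serve in \<open>T\<close>.\<close>

lemma tool_level_mono:
  assumes "tool n k (Suc j) p L b"
  shows "tool n k j p L b"
proof -
  from assms obtain F where F: "F \<in> palettes k (Suc (Suc j))"
    "\<forall>c\<in>F. \<exists>v\<in>{1..n}. L v = b \<and> colouring p v = Some c"
    unfolding tool_def by blast
  then have "card F \<noteq> 0"
    by (simp add: palettes_def)
  then obtain c where "c \<in> F"
    by fastforce
  then have "F - {c} \<in> palettes k (Suc j)"
    using F(1) by (auto simp: palettes_def)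
  then show ?thesis
    unfolding tool_def by (rule bexI[rotated]) (use F(2) in simp)
qed

lemma pairing_join:
  assumes st: "pairing n k j p L A P D T" and y: "L y \<notin> A \<union> P \<union> D \<union> T"
  shows "pairing n k j (join p x y) (merge L x y) A P D T"
proof -
  have ne: "c \<noteq> L y" if "c \<in> A \<union> P \<union> D \<union> T" for c
    using that y by metis
  have "single n k j (join p x y) (merge L x y) c" if "c \<in> A" for c
    using that st join_frame(1)[of c L y n k "j" p x] ne[of c] by (simp add: pairing_def)
  moreover have "pair n k j (join p x y) (merge L x y) c" if "c \<in> P" for c
    using that st join_frame(2)[of c L y n k "j" p x] ne[of c] by (simp add: pairing_def)
  moreover have "single n k (Suc j) (join p x y) (merge L x y) c" if "c \<in> D" for c
    using that st join_frame(1)[of c L y n k "Suc j" p x] ne[of c] by (simp add: pairing_def)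
  moreover have "tool n k j (join p x y) (merge L x y) c" if "c \<in> T" for c
    using that st join_frame(4)[of c L y n k "j" p x] ne[of c] by (simp add: pairing_def)
  ultimately show ?thesis
    using st unfolding pairing_def by blast
qed

text \<open>No block is wasted: a spoiled block of \<open>A\<close> or \<open>D\<close> goes to
  \<open>T\<close>, one of \<open>P\<close> goes to \<open>D\<close>. The weighted sum never falls,
  and the lead of \<open>card T\<close> over \<open>card P\<close> grows by at most one.\<close>

lemma pairing_painter_move:
  assumes q: "blocks n k q L" and m: "painter_move n k q p'"
    and st: "pairing n k j q L A P D T" and c: "card T = card P"
    and N: "N < card A + 2 * (card P + card T + card D)"
  obtains A' P' D' T' where "pairing n k j p' L A' P' D' T'"
    "card T' = card P' \<or> card T' = Suc (card P')"
    "N < card A' + 2 * (card P' + card T' + card D')"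
proof -
  from m obtain v i where v: "v \<in> {1..n}" "i \<in> {1..k}" "colouring q v = None" "properly_coloured p'"
    and p': "p' = q\<lparr>colouring := (colouring q)(v \<mapsto> i)\<rparr>"
    unfolding painter_move_def by blast
  note col = q v p'
  from st have fin: "finite A" "finite P" "finite D" "finite T"
    and disj: "A \<inter> P = {}" "A \<inter> D = {}" "A \<inter> T = {}" "P \<inter> D = {}" "P \<inter> T = {}" "D \<inter> T = {}"
    and blk: "\<forall>b\<in>A. single n k j q L b" "\<forall>b\<in>P. pair n k j q L b" "\<forall>b\<in>D. single n k (Suc j) q L b"
      "\<forall>b\<in>T. tool n k j q L b"
    unfolding pairing_def by blast+
  have T': "\<forall>b\<in>T. tool n k j p' L b"
    using blk(4) tool_colour[OF col] by blast
  have fr: "\<forall>b\<in>A - {L v}. single n k j p' L b" "\<forall>b\<in>P - {L v}. pair n k j p' L b"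
    "\<forall>b\<in>D - {L v}. single n k (Suc j) p' L b"
    using blk frame_colour[OF col] by blast+
  consider "L v \<in> A" "\<not> single n k j p' L (L v)" | "L v \<in> P" "\<not> pair n k j p' L (L v)"
    | "L v \<in> D" "\<not> single n k (Suc j) p' L (L v)"
    | "L v \<in> A \<Longrightarrow> single n k j p' L (L v)" "L v \<in> P \<Longrightarrow> pair n k j p' L (L v)"
      "L v \<in> D \<Longrightarrow> single n k (Suc j) p' L (L v)"
    by blast
  then show thesis
  proof cases
    case 1
    then have "tool n k j p' L (L v)"
      using single_colour[OF col] blk(1) by blast
    moreover have "L v \<notin> P" "L v \<notin> D" "L v \<notin> T"
      using 1 disj by auto
    ultimately have "pairing n k j p' L (A - {L v}) P D (insert (L v) T)"
      unfolding pairing_def using fin disj T' fr by auto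
    then show thesis
      by (rule that) (use c N fin \<open>L v \<notin> T\<close> card_Suc_Diff1[OF fin(1) 1(1)] in auto)
  next
    case 2
    then have "single n k (Suc j) p' L (L v)"
      using pair_colour[OF col] blk(2) by blast
    moreover have "L v \<notin> A" "L v \<notin> D" "L v \<notin> T"
      using 2 disj by auto
    ultimately have "pairing n k j p' L A (P - {L v}) (insert (L v) D) T"
      unfolding pairing_def using fin disj T' fr by auto
    then show thesis
      by (rule that) (use c N fin \<open>L v \<notin> D\<close> card_Suc_Diff1[OF fin(2) 2(1)] in auto)
  next
    case 3
    then have "tool n k j p' L (L v)"
      using single_colour[OF col] blk(3) tool_level_mono by blast
    moreover have "L v \<notin> A" "L v \<notin> P" "L v \<notin> T"
      using 3 disj by auto
    ultimately have "pairing n k j p' L A P (D - {L v}) (insert (L v) T)"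
      unfolding pairing_def using fin disj T' fr by auto
    then show thesis
      by (rule that) (use c N fin \<open>L v \<notin> T\<close> card_Suc_Diff1[OF fin(3) 3(1)] in auto)
  next
    case 4
    then have "\<forall>b\<in>A. single n k j p' L b" "\<forall>b\<in>P. pair n k j p' L b" "\<forall>b\<in>D. single n k (Suc j) p' L b"
      using fr by blast+
    then have "pairing n k j p' L A P D T"
      unfolding pairing_def using fin disj T' by blast
    then show thesis
      by (rule that) (use c N in auto)
  qed
qed

text \<open>If there are as many tools as pairs, then the uncoloured vertices in \<open>A\<close>, \<open>P\<close> and \<open>D\<close> outnumber
  the blocks used so far, so that some block is still unused.\<close>

lemma unused_block:
  assumes ob: "open_blocks n k p L" and st: "pairing n k j p L A P D T" and c: "card T = card P"
  obtains y where "y \<in> {1..n}" "L y \<notin> A \<union> P \<union> D \<union> T"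
proof -
  define U where "U = {v \<in> {1..n}. colouring p v = None}"
  define f where "f b = {v \<in> U. L v = b}" for b
  from st have fin: "finite A" "finite P" "finite D" "finite T"
    and disj: "A \<inter> P = {}" "A \<inter> D = {}" "P \<inter> D = {}"
    and blk: "\<forall>b\<in>A. single n k j p L b" "\<forall>b\<in>P. pair n k j p L b" "\<forall>b\<in>D. single n k (Suc j) p L b"
    unfolding pairing_def by blast+
  have finU: "finite U" "finite (f b)" for b
    by (auto simp: U_def f_def)
  have b: "blocks n k p L" "n < card (L ` {1..n}) + card (dom (colouring p))"
    using ob by (auto simp: open_blocks_def)
  have U: "U = {1..n} - dom (colouring p)"
    by (auto simp: U_def domIff)
  have "card U = n - card (dom (colouring p))"
    unfolding U using blocks_dom[OF b(1)] by (simp add: card_Diff_subset finite_subset)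
  moreover have "card (dom (colouring p)) \<le> n"
    using card_mono[OF _ blocks_dom[OF b(1)]] by simp
  ultimately have lt: "card U < card (L ` {1..n})"
    using b(2) by linarith
  have one: "1 \<le> card (f b)" if "single n k l p L b" for b l
  proof -
    from that obtain v where "v \<in> f b"
      unfolding single_def sees_def f_def U_def by blast
    then have "card (f b) \<noteq> 0"
      using finU by auto
    then show ?thesis by simp
  qed
  have two: "2 \<le> card (f x)" if "pair n k j p L x" for x
  proof -
    from that obtain u w where "{u, w} \<in> edges p" and uw: "{u, w} \<subseteq> f x"
      unfolding pair_def sees_def f_def U_def by blast
    with blocks_edge(2)[OF b(1)] have "card {u, w} = 2"
      by simp
    with card_mono[OF finU(2) uw] show ?thesis by simp
  qed
  \<comment> \<open>The second uncoloured vertex of each pair stands for one tool, as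
    \<open>card T = card P\<close>.\<close>
  have "card A + card P + card D + card P \<le> (\<Sum>b\<in>A. card (f b)) + (\<Sum>b\<in>P. card (f b)) + (\<Sum>b\<in>D. card (f b))"
    using sum_mono[of A "\<lambda>_. 1" "\<lambda>b. card (f b)"] sum_mono[of P "\<lambda>_. 2" "\<lambda>b. card (f b)"]
      sum_mono[of D "\<lambda>_. 1" "\<lambda>b. card (f b)"] one two blk by fastforce
  also have "\<dots> = (\<Sum>b\<in>A \<union> P \<union> D. card (f b))"
    using fin disj by (simp add: sum.union_disjoint Int_Un_distrib2)
  also have "\<dots> = card (\<Union>b\<in>A \<union> P \<union> D. f b)"
    by (rule card_UN_disjoint[symmetric]) (use fin finU in \<open>auto simp: f_def\<close>)
  also have "\<dots> \<le> card U"
    by (rule card_mono[OF finU(1)]) (auto simp: f_def)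
  finally have "card A + card P + card D + card T < card (L ` {1..n})"
    using lt c by simp
  moreover have "card (A \<union> P \<union> D \<union> T) \<le> card A + card P + card D + card T"
    using card_Un_le[of "A \<union> P \<union> D" T] card_Un_le[of "A \<union> P" D] card_Un_le[of A P] by linarith
  ultimately have "\<not> L ` {1..n} \<subseteq> A \<union> P \<union> D \<union> T"
    using card_mono[of "A \<union> P \<union> D \<union> T" "L ` {1..n}"] fin by auto
  then show thesis
    using that by blast
qed

text \<open>A move of Painter that spoils a block makes \<open>card T\<close> exceed \<open>card P\<close>, and Builder answers with a
  new pair; after any other move of Painter there is an unused block to waste.\<close>

lemma pair_phase:
  assumes up: "\<And>p L B. open_blocks n k p L \<Longrightarrow> finite B \<Longrightarrow> m \<le> card B \<Longrightarrow>
      \<forall>b\<in>B. single n k (Suc j) p L b \<Longrightarrow> forced n k p"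
    and "open_blocks n k p L" and "pairing n k j p L A P D T"
    and "card T = card P \<or> card T = Suc (card P)"
    and "10 * m + 2 ^ k < card A + 2 * (card P + card T + card D)"
  shows "forced n k p"
  using assms(2-)
proof (induction "n - card (dom (colouring p))" arbitrary: p L A P D T rule: less_induct)
  case less
  note ob = less.prems(1) and st = less.prems(2) and TP = less.prems(3) and big = less.prems(4)
  from st have fin: "finite A" "finite P" "finite D" "finite T"
    and disj: "A \<inter> P = {}" "A \<inter> D = {}" "A \<inter> T = {}" "P \<inter> D = {}" "P \<inter> T = {}" "D \<inter> T = {}"
    and blk: "\<forall>b\<in>A. single n k j p L b" "\<forall>b\<in>P. pair n k j p L b" "\<forall>b\<in>D. single n k (Suc j) p L b"
      "\<forall>b\<in>T. tool n k j p L b"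
    unfolding pairing_def by blast+
  have move: "forced n k p"
    if xy: "x \<in> {1..n}" "y \<in> {1..n}" "L x \<noteq> L y" "colouring p x = None"
      and st': "pairing n k j (join p x y) (merge L x y) A' P' D T" and c': "card T = card P'"
      and big': "10 * m + 2 ^ k < card A' + 2 * (card P' + card T + card D)"
    for x y A' P'
  proof (rule forced_join[OF ob xy])
    fix p' assume m: "painter_move n k (join p x y) p'"
      and ob': "open_blocks n k p' (merge L x y)"
      and dec: "n - card (dom (colouring p')) < n - card (dom (colouring p))"
    have bq: "blocks n k (join p x y) (merge L x y)"
      using blocks_join(1)[OF _ xy] ob unfolding open_blocks_def by blast
    show "forced n k p'"
      by (rule pairing_painter_move[OF bq m st' c' big']) (rule less.hyps[OF dec ob'])
  qed
  consider "m \<le> card D" | "2 * m \<le> card P" | "card D < m" "card P < 2 * m"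
    by linarith
  then show ?case
  proof cases
    case 1
    show ?thesis
      by (rule up[OF ob fin(3) 1 blk(3)])
  next
    case 2
    \<comment> \<open>As \<open>card P \<le> card T\<close>, both sums are at least
      \<open>2 * m\<close> already with \<open>R\<close> empty.\<close>
    show ?thesis
      by (rule raise_phase[OF up ob, where P = P and T = T and R = "{}" and D = D])
        (use 2 fin disj blk TP in auto)
  next
    case 3
    \<comment> \<open>Since \<open>card T \<le> card P + 1 \<le> 2 * m\<close>, the blocks outside
      \<open>A\<close> contribute less than \<open>2 * (2 * m + 2 * m + m) = 10 * m\<close>, which
      leaves more than \<open>2 ^ k\<close> for \<open>A\<close>.\<close>
    with big TP have A: "2 ^ k < card A"
      by auto
    from TP show ?thesis
    proof
      assume TP: "card T = card P"
      obtain y where y: "y \<in> {1..n}" "L y \<notin> A \<union> P \<union> D \<union> T"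
        using unused_block[OF ob st TP] by blast
      from A obtain a where a: "a \<in> A"
        by fastforce
      with blk(1) obtain x where "L x = a" and x: "x \<in> {1..n}" "colouring p x = None"
        unfolding single_def sees_def by blast
      with a have "L x \<in> A"
        by simp
      have "pairing n k j (join p x y) (merge L x y) A P D T"
        by (rule pairing_join[OF st y(2)])
      with x y TP big \<open>L x \<in> A\<close> show ?thesis
        by (intro move[of x y A P]) auto
    next
      assume TP: "card T = Suc (card P)"
      from blk(1) have "\<forall>b\<in>A. \<exists>v F. L v = b \<and> F \<in> palettes k j \<and> sees n p F v"
        unfolding single_def by blast
      then obtain g F where gF: "\<And>b. b \<in> A \<Longrightarrow> L (g b) = b \<and> F b \<in> palettes k j \<and> sees n p (F b) (g b)"
        by metis
      \<comment> \<open>There are at most \<open>2 ^ k\<close> palettes, so two blocks of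
        \<open>A\<close> share one and can form a pair.\<close>
      have "card (F ` A) \<le> card (Pow {1..k})"
        by (rule card_mono) (use gF in \<open>auto simp: palettes_def\<close>)
      with A have "card (F ` A) < card A"
        by (simp add: card_Pow)
      then have "\<not> inj_on F A"
        by (rule pigeonhole)
      then obtain a b where ab: "a \<in> A" "b \<in> A" "a \<noteq> b" "F a = F b"
        unfolding inj_on_def by blast
      define x y where "x = g a" and "y = g b"
      have x: "L x = a" "F a \<in> palettes k j" "sees n p (F a) x" and y: "L y = b" "sees n p (F a) y"
        using gF[OF ab(1)] gF[OF ab(2)] ab(4) by (auto simp: x_def y_def)
      have "pair n k j (join p x y) (merge L x y) a"
        unfolding pair_def
        using x y sees_join[of n p "F a" _ x y]
        by (intro exI[of _ x] exI[of _ y] conjI bexI[of _ "F a"]) (simp_all add: merge_def)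
      moreover have "pairing n k j p L (A - {a, b}) P D T"
        using st by (auto simp: pairing_def)
      moreover have a: "a \<notin> P" "a \<notin> D" "a \<notin> T"
        using ab(1) disj by blast+
      moreover have "L y \<notin> (A - {a, b}) \<union> P \<union> D \<union> T"
        using y(1) ab(2) disj by blast
      ultimately have "pairing n k j (join p x y) (merge L x y) (A - {a, b}) (insert a P) D T"
        using pairing_join[of n k j p L "A - {a, b}" P D T y x]
        by (simp add: pairing_def Int_insert_left Int_insert_right)
      moreover note \<open>a \<notin> P\<close>
      \<comment> \<open>Two blocks of weight 1 become one pair of weight 2, so the weighted sum is
        kept.\<close>
      moreover have "card A = Suc (Suc (card (A - {a, b})))"
        using card_Suc_Diff1[OF fin(1) ab(1)] card_Suc_Diff1[of "A - {a}" b] fin(1) ab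
        by (simp add: Diff_insert2[symmetric])
      ultimately show ?thesis
        using x y ab(3) TP big fin
        by (intro move[of x y "A - {a, b}" "insert a P"]) (auto simp: sees_def)
    qed
  qed
qed

section \<open>Induction over levels and the opening\<close>

text \<open>Here \<open>d\<close> counts the missing levels. The factor 16 per level suffices
  because \<open>10 * m + 2 ^ k < 16 * m\<close> for \<open>m \<ge> 2 ^ k\<close>. At
  \<open>d = 0\<close> the only palette is the full set of colours.\<close>

lemma forced_level:
  assumes "d \<le> k" "open_blocks n k p L" "finite B" "2 ^ k * 16 ^ d \<le> card B"
    "\<forall>b\<in>B. single n k (k - d) p L b"
  shows "forced n k p"
  using assms
proof (induction d arbitrary: p L B)
  case 0
  then obtain b where "b \<in> B"
    by fastforce
  with 0 obtain v F where v: "F \<in> palettes k k" "sees n p F v"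
    unfolding single_def diff_zero by blast
  then have "F = {1..k}"
    using card_subset_eq[of "{1..k}" F] by (simp add: palettes_def)
  with v show ?case
    by (intro forced_won) (auto simp: sees_def)
next
  case (Suc d)
  have k: "Suc (k - Suc d) = k - d"
    using Suc.prems(1) by simp
  have up: "forced n k p" if "open_blocks n k p L" "finite B" "2 ^ k * 16 ^ d \<le> card B"
    "\<forall>b\<in>B. single n k (Suc (k - Suc d)) p L b" for p L B
    using that Suc.IH Suc.prems(1) unfolding k by simp
  have "2 ^ k \<le> (2 ^ k * 16 ^ d :: nat)" "0 < (2 ^ k * 16 ^ d :: nat)"
    by simp_all
  then have "10 * (2 ^ k * 16 ^ d) + 2 ^ k < 16 * (2 ^ k * 16 ^ d :: nat)"
    by linarith
  also have "\<dots> \<le> card B"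
    using Suc.prems(4) by simp
  finally show ?case
    using Suc.prems by (intro pair_phase[OF up, where A = B and P = "{}" and D = "{}" and T = "{}"])
      (auto simp: pairing_def)
qed

text \<open>After the opening move each vertex is its own block: \<open>n\<close> blocks and one
  coloured vertex establish \<open>open_blocks\<close>, and every uncoloured vertex sees the empty
  palette.\<close>

lemma builder_wins:
  assumes "2 ^ k * 16 ^ k < n"
  shows "\<exists>s. winning_strategy n k Builder s \<and> keeps_bipartite n k Builder s"
proof (rule builder_wins_if_forced)
  show "0 < n"
    using assms by simp
next
  fix p assume m: "painter_move n k start p"
  have "blocks n k start id"
    by (auto simp: blocks_def bisected_def start_def properly_coloured_def)
  from blocks_painter_move[OF this m] have b: "blocks n k p id" "card (dom (colouring p)) = 1"
    by (auto simp: start_def)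
  define B where "B = {1..n} - dom (colouring p)"
  have "card B = n - 1"
    unfolding B_def using b(2) blocks_dom[OF b(1)]
    by (simp add: card_Diff_subset finite_subset)
  show "forced n k p"
  proof (rule forced_level[of k k n p id B])
    show "open_blocks n k p id"
      using b by (simp add: open_blocks_def)
    show "\<forall>b\<in>B. single n k (k - k) p id b"
      by (auto simp: single_def sees_def palettes_def B_def domIff)
  qed (use \<open>card B = n - 1\<close> assms in \<open>auto simp: B_def\<close>)
qed

section \<open>The value of \<open>k_min\<close>\<close>

theorem theorem1:
  fixes n :: nat
  assumes "n > 10 ^ 8"
  shows "0.01 * log 2 (real n) < real (k_min n) \<and> real (k_min n) \<le> log 2 (real n) + 1 \<and>
    (\<forall>k::nat. 0 < k \<and> real k \<le> 0.01 * log 2 (real n) \<longrightarrow>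
      (\<exists>s. winning_strategy n k Builder s \<and> keeps_bipartite n k Builder s))"
proof (intro conjI)
  have n: "0 < real n"
    using assms by simp
  have builder: "\<exists>s. winning_strategy n k Builder s \<and> keeps_bipartite n k Builder s"
    if k: "0 < k" "real k \<le> 0.01 * log 2 (real n)" for k
  proof (rule builder_wins)
    have "real (100 * k) \<le> log 2 (real n)"
      using k(2) by simp
    then have "2 powr real (100 * k) \<le> real n"
      using n by (simp only: le_log_iff)
    then have "2 ^ (100 * k) \<le> real n"
      by (simp only: powr_realpow)
    then have "2 ^ (100 * k) \<le> n"
      by (metis of_nat_le_iff of_nat_numeral of_nat_power)
    \<comment> \<open>As \<open>16 = 2 ^ 4\<close>, the threshold is \<open>2 ^ (5 * k)\<close>,
      below \<open>2 ^ (100 * k)\<close> for positive \<open>k\<close>.\<close>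
    moreover have "2 ^ k * 16 ^ k = (2 :: nat) ^ (5 * k)"
      by (simp add: power_mult flip: power_mult_distrib)
    moreover have "(2 :: nat) ^ (5 * k) < 2 ^ (100 * k)"
      using k(1) by (intro power_strict_increasing) simp_all
    ultimately show "2 ^ k * 16 ^ k < n"
      by linarith
  qed
  then show "\<forall>k::nat. 0 < k \<and> real k \<le> 0.01 * log 2 (real n) \<longrightarrow>
      (\<exists>s. winning_strategy n k Builder s \<and> keeps_bipartite n k Builder s)"
    by blast
  \<comment> \<open>The least integer strictly above the logarithm: large enough for
    \<open>n < 2 ^ K\<close>, and at most \<open>log 2 n + 1\<close>.\<close>
  define K where "K = nat \<lfloor>log 2 (real n)\<rfloor> + 1"
  have "8 \<le> real n"
    using assms by simp
  then have log3: "3 \<le> log 2 (real n)"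
    using n by (simp add: le_log_iff)
  then have "log 2 (real n) < real K" "real K \<le> log 2 (real n) + 1" "3 \<le> K"
    unfolding K_def by linarith+
  then have "real n < 2 ^ K"
    using n by (simp add: log_less_iff powr_realpow)
  then have "n < 2 ^ K"
    by (metis of_nat_less_iff of_nat_numeral of_nat_power)
  then have win: "0 < K \<and> (\<exists>s. winning_strategy n K Painter s)"
    using painter_wins \<open>3 \<le> K\<close> by simp
  then have "k_min n \<le> K"
    unfolding k_min_def by (rule Least_le)
  then show "real (k_min n) \<le> log 2 (real n) + 1"
    using \<open>real K \<le> log 2 (real n) + 1\<close> by linarith
  have min: "0 < k_min n \<and> (\<exists>s. winning_strategy n (k_min n) Painter s)"
    unfolding k_min_def by (rule LeastI[of _ K]) (rule win)
  \<comment> \<open>If the bound failed, both players would have winning strategies with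
    \<open>k_min n\<close> colours.\<close>
  show "0.01 * log 2 (real n) < real (k_min n)"
  proof (rule ccontr)
    assume "\<not> ?thesis"
    then obtain t where "winning_strategy n (k_min n) Builder t"
      using builder[of "k_min n"] min by auto
    with min show False
      using not_both_winning by blast
  qed
qed

end
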